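(* Fix $\varepsilon>0$ and let $u^\varepsilon$ be a smooth solution of the renormalized equation $$(\partial_t-\Delta+m^2)u^\varepsilon(z)=F^\varepsilon(z,u^\varepsilon(z))$$ on $\mathbb T^d$ with initial condition $u_0\in L^\infty(\mathbb T^d)$. For $a\in\mathbb R$ let $\Phi^\varepsilon(\cdot,a):\mathbb R_+\times\mathbb T^d\to\mathbb R$ solve $$(\partial_t-\Delta+m^2)\Phi^\varepsilon(z,a)=m^2a+F^\varepsilon(z,\Phi^\varepsilon(z,a)),\qquad\Phi^\varepsilon(0,\cdot,a)=a.$$ For some $\delta\in(0,1)$, let $T_\delta>0$ be such that $$\sup_{a\in\mathbb R}\ \sup_{z\in[0,T_\delta]\times\mathbb T^d}|\Phi^\varepsilon(z,a)-a|\le\delta\quad\text{and}\quad 1-\delta\le\sup_{a\in\mathbb R}\ \sup_{z\in[0,T_\delta]\times\mathbb T^d}\partial_a\Phi^\varepsilon(z,a)\le1+\delta .$$ Then for all $t\in[0,T_\delta]$, $$\|u^\varepsilon(t)\|_\infty\le e^{-\frac{m^2}{1+\delta}t}\,\|u_0\|_\infty+\delta.$$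
   Context: $\mathbb T^d$ is the $d$-dimensional torus, $m^2\ge0$, $z=(t,x)$ denotes a space-time point, and $\|\cdot\|_\infty$ is the $L^\infty(\mathbb T^d)$ norm. $F^\varepsilon$ is the renormalized nonlinearity of the singular SPDE $(\partial_t-\Delta+m^2)u=\sum_{i=1}^\ell\sigma_i(u)\xi_i$, where $\sigma_i:\mathbb R\to\mathbb R$ are smooth with sufficiently many bounded derivatives and $\xi_i\in\mathscr C_{\mathfrak s}^{-\bar\beta}(\mathbb R\times\mathbb T^d)$ (Hölder–Besov space with parabolic scaling $\mathfrak s=(2,1,\dots,1)$), $\bar\beta\in(0,2)$. Precisely: take smooth regularizations $\xi_i^\varepsilon$ of the noises and an admissible model $Z^\varepsilon$ lifting them, renormalized via a strong preparation map in the sense of Bailleul–Bruned. The model is defined on the regularity structure associated with the equation following Hairer's construction ("A theory of regularity structures", 2014): it is spanned by the symbols in $\mathcal W\cup\mathcal V$, the smallest sets such that $\mathcal V$ contains all polynomials $X^k$ and is closed under products, $\Xi_i\tau\in\mathcal W$ for $\tau\in\mathcal V$, and $\mathcal I(\tau)\in\mathcal V$ for $\tau\in\mathcal W$, where $\Xi_i$ are abstract noise symbols, $\mathcal I$ is the abstract integration map for the heat kernel, and homogeneities are $|\Xi_i|=-\bar\beta$, $|X^k|=|k|_{\mathfrak s}$, $|\mathcal I\tau|=|\tau|+2$, additive under products; its structure group consists of linear multiplicative maps $\Gamma$ that fix each $\Xi_i$, act on polynomials by translation $X^k\mapsto(X+h)^k$, are such that $\Gamma\mathcal I(\tau)-\mathcal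 I(\Gamma\tau)$ is a polynomial, and change each symbol only by terms of strictly lower homogeneity. Then the reconstruction $u^\varepsilon$ of the solution of the abstract fixed point problem solves an equation of the form $(\partial_t-\Delta+m^2)u^\varepsilon(z)=F^\varepsilon(z,u^\varepsilon(z))=:\sum_i\sigma_i(u^\varepsilon)\diamond\xi_i^\varepsilon$. The exact form of $F^\varepsilon$ plays no role; what matters is that $F^\varepsilon:(\mathbb R_+\times\mathbb T^d)\times\mathbb R\to\mathbb R$ is a function of the space-time point and of the value of the solution at that point only (local), and that for fixed $\varepsilon>0$ it is qualitatively smooth and bounded. In this situation $a\mapsto\Phi^\varepsilon(z,a)$ is differentiable. *)

theory Defs
  imports "HOL-Analysis.Analysis" "HOL-Probability.Essential_Supremum"
begin

text \<open>
  Functions on the torus \<open>\<real>\<^sup>d / \<int>\<^sup>d\<close> are represented by \<open>\<int>\<^sup>d\<close>-periodic functions on \<open>real ^ 'd\<close>,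
  and its normalised Haar measure by Lebesgue measure on the fundamental cell \<open>[0,1)\<^sup>d\<close>.
\<close>

definition torus_fun :: "(real ^ 'd \<Rightarrow> real) \<Rightarrow> bool" where
  "torus_fun f \<longleftrightarrow> (\<forall>x k. (\<forall>i. k $ i \<in> \<int>) \<longrightarrow> f (x + k) = f x)"

definition torus_measure :: "(real ^ 'd) measure" where
  "torus_measure = lebesgue_on {x. \<forall>i. 0 \<le> x $ i \<and> x $ i < 1}"

definition Linf_norm :: "(real ^ 'd \<Rightarrow> real) \<Rightarrow> ereal" where
  "Linf_norm f = esssup torus_measure (\<lambda>x. ereal \<bar>f x\<bar>)"

definition Linf_torus :: "(real ^ 'd \<Rightarrow> real) set" where
  "Linf_torus = {f. torus_fun f \<and> f \<in> borel_measurable torus_measure \<and> Linf_norm f < \<infinity>}"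

primrec Ck_on :: "nat \<Rightarrow> 'a::euclidean_space set \<Rightarrow> ('a \<Rightarrow> real) \<Rightarrow> bool" where
  "Ck_on 0 U f \<longleftrightarrow> continuous_on U f"
| "Ck_on (Suc k) U f \<longleftrightarrow> (\<forall>x\<in>U. f differentiable (at x)) \<and>
     (\<forall>v. Ck_on k U (\<lambda>x. frechet_derivative f (at x) v))"

text \<open>
  Smoothness on an arbitrary set means having a smooth extension to an open neighbourhood; for
  open sets this is the usual notion, for half spaces it is smoothness up to the boundary.
\<close>

definition smooth_on :: "'a::euclidean_space set \<Rightarrow> ('a \<Rightarrow> real) \<Rightarrow> bool" where
  "smooth_on S f \<longleftrightarrow>
     (\<exists>U g. open U \<and> S \<subseteq> U \<and> (\<forall>k. Ck_on k U g) \<and> (\<forall>x\<in>S. g x = f x))"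

definition time_deriv :: "(real \<times> (real ^ 'd) \<Rightarrow> real) \<Rightarrow> real \<times> (real ^ 'd) \<Rightarrow> real" where
  "time_deriv v = (\<lambda>(t, x). deriv (\<lambda>s. v (s, x)) t)"

definition laplacian :: "(real \<times> (real ^ 'd) \<Rightarrow> real) \<Rightarrow> real \<times> (real ^ 'd) \<Rightarrow> real" where
  "laplacian v = (\<lambda>(t, x). \<Sum>i\<in>UNIV. (deriv ^^ 2) (\<lambda>h. v (t, x + h *\<^sub>R axis i 1)) 0)"

definition heat_op :: "real \<Rightarrow> (real \<times> (real ^ 'd) \<Rightarrow> real) \<Rightarrow> real \<times> (real ^ 'd) \<Rightarrow> real" where
  "heat_op m v z = time_deriv v z - laplacian v z + m\<^sup>2 * v z"

text \<open>
  Solutions are smooth and satisfy the equation pointwise at positive times. As the initial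
  condition is merely bounded, it cannot be attained uniformly as \<open>t\<close> tends to \<open>0\<close>; it is attained
  in \<open>L\<^sup>1\<close>, which for a bounded nonlinearity is equivalent to the mild (Duhamel) formulation.
\<close>

definition solves_ivp ::
  "real \<Rightarrow> (real \<times> (real ^ 'd) \<Rightarrow> real \<Rightarrow> real) \<Rightarrow> (real ^ 'd \<Rightarrow> real) \<Rightarrow>
    (real \<times> (real ^ 'd) \<Rightarrow> real) \<Rightarrow> bool" where
  "solves_ivp m G v0 v \<longleftrightarrow>
     (\<forall>t\<ge>0. torus_fun (\<lambda>x. v (t, x))) \<and>
     smooth_on ({0<..} \<times> UNIV) v \<and>
     (\<forall>z \<in> {0<..} \<times> UNIV. heat_op m v z = G z (v z)) \<and>
     (\<forall>x. v (0, x) = v0 x) \<and>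
     ((\<lambda>t. \<integral>x. \<bar>v (t, x) - v0 x\<bar> \<partial>torus_measure) \<longlongrightarrow> 0) (at_right 0)"

text \<open>
  A local nonlinearity \<open>F(z, a)\<close>, \<open>z = (t, x)\<close>, that is smooth and bounded on
  \<open>[0,\<infinity>) \<times> \<real>\<^sup>d / \<int>\<^sup>d \<times> \<real>\<close>.
\<close>

definition smooth_bounded_nonlinearity :: "(real \<times> (real ^ 'd) \<Rightarrow> real \<Rightarrow> real) \<Rightarrow> bool" where
  "smooth_bounded_nonlinearity F \<longleftrightarrow>
     (\<forall>t\<ge>0. \<forall>a. torus_fun (\<lambda>x. F (t, x) a)) \<and>
     smooth_on (({0..} \<times> UNIV) \<times> UNIV) (\<lambda>(z, a). F z a) \<and>
     bounded ((\<lambda>(z, a). F z a) ` (({0..} \<times> UNIV) \<times> UNIV))"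

end

theory Submission
  imports Defs
begin

text \<open>
  Write \<open>\<kappa> = m\<^sup>2 / (1 + \<delta>)\<close> and \<open>A = \<parallel>u0\<parallel>\<close>. The upper bound comes from the barrier
  \<open>w (t, x) = \<Phi> (t, x) (a t)\<close> with \<open>a t = A exp (- \<kappa> t)\<close>. Formally
  \<open>(\<partial>\<^sub>t - \<Delta> + m\<^sup>2) w = F(w) + m\<^sup>2 a + a' \<partial>\<^sub>a\<Phi>\<close>, and
  \<open>m\<^sup>2 a + a' \<partial>\<^sub>a\<Phi> = m\<^sup>2 a (1 - \<partial>\<^sub>a\<Phi> / (1 + \<delta>)) \<ge> 0\<close>. Hence \<open>w\<close> is a supersolution starting above \<open>u0\<close>, and
  comparison gives \<open>u \<le> w \<le> a + \<delta>\<close>. The problem is invariant under changing the signs of \<open>u\<close>, \<open>\<Phi>\<close>, \<open>F\<close> and of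
  the arguments \<open>a\<close> and \<open>b\<close>, so the same bound holds for \<open>- u\<close>.

  Two points need care. First, \<open>\<Phi>\<close> is smooth in space-time for each \<open>a\<close> and differentiable in \<open>a\<close> at each
  space-time point, but nothing is known about it as a function of both arguments, so the chain rule behind the
  formal computation is not available. The parameter is therefore decreased in jumps: on each of many short time
  intervals it has a constant value \<open>a'\<close>. By the mean value theorem, the jump from \<open>a\<close> to \<open>a'\<close> lowers the barrier by
  at most \<open>(1 + \<delta>) (a - a')\<close>. The source term \<open>m\<^sup>2 a'\<close> pays for this during the next interval: the comparison
  function \<open>\<Phi> z a' + c (t1 - t)\<close> is still a supersolution as long as \<open>c (1 + L h) \<le> m\<^sup>2 a'\<close>, where \<open>L\<close> is a
  Lipschitz constant of \<open>F\<close> and \<open>h\<close> the length of the interval. For any rate \<open>\<theta> \<kappa>\<close> with \<open>\<theta> < 1\<close> there is room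
  for this when \<open>h\<close> is small (\<open>barrier_chain\<close>), and one lets first \<open>h\<close> tend to \<open>0\<close> and then \<open>\<theta>\<close> to \<open>1\<close>
  (\<open>solution_upper_bound\<close>).

  Second, the initial value is attained only in \<open>L\<^sup>1\<close>, so the comparison principle (\<open>subsolution_nonpos\<close>) is proved by
  an \<open>L\<^sup>1\<close> argument: for a subsolution \<open>v\<close> of the heat equation, the integral of \<open>\<beta>(v)\<close> over the torus does not
  increase, where \<open>\<beta>\<close> is convex, nondecreasing, zero on the negative axis, and at most the positive part. It is used a
  first time to show that \<open>u\<close> is bounded (\<open>comparison_bounded_rhs\<close>), so that \<open>F\<close> is Lipschitz on the range that
  matters.
\<close>

section \<open>A convex profile of linear growth\<close>

text \<open>
  A twice continuously differentiable convex substitute for the positive part. It must not grow faster than the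
  positive part itself, because only \<open>L\<^sup>1\<close> information is available at the initial time; this excludes its higher powers.
\<close>

definition positive_part_profile :: "real \<Rightarrow> real" where
  "positive_part_profile r = max 0 r - arctan (max 0 r)"

definition profile_deriv :: "real \<Rightarrow> real" where
  "profile_deriv r = 1 - inverse (1 + (max 0 r)\<^sup>2)"

definition profile_deriv2 :: "real \<Rightarrow> real" where
  "profile_deriv2 r = 2 * max 0 r * (inverse (1 + (max 0 r)\<^sup>2))\<^sup>2"

text \<open>
  Truncating at \<open>0\<close> creates no kink because the one-sided slopes at \<open>0\<close> agree.
\<close>

lemma DERIV_max_zero:
  fixes f f' :: "real \<Rightarrow> real"
  assumes der: "\<And>r. (f has_real_derivative f' r) (at r)" and f'0: "f' 0 = 0"
  shows "((\<lambda>r. f (max 0 r)) has_real_derivative f' (max 0 r)) (at r)"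
proof (cases r "0::real" rule: linorder_cases)
  case less
  have "((\<lambda>r. f 0) has_real_derivative f' (max 0 r)) (at r)"
    using less f'0 by (simp add: max_def)
  then show ?thesis
    by (rule has_field_derivative_transform_within_open[where S = "{..<0}"]) (use less in auto)
next
  case greater
  have "(f has_real_derivative f' (max 0 r)) (at r)"
    using greater der[of r] by simp
  then show ?thesis
    by (rule has_field_derivative_transform_within_open[where S = "{0<..}"]) (use greater in auto)
next
  case equal
  have lim: "((\<lambda>h. (f h - f 0) / h) \<longlongrightarrow> 0) (at 0)"
    using der[of 0] f'0 by (simp add: has_field_derivative_iff)
  have "((\<lambda>h. (f (max 0 h) - f 0) / h) \<longlongrightarrow> 0) (at 0)"
  proof (rule Lim_null_comparison)
    show "\<forall>\<^sub>F h in at 0. norm ((f (max 0 h) - f 0) / h) \<le> \<bar>(f h - f 0) / h\<bar>"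
      by (rule always_eventually) (auto simp: max_def divide_le_0_iff)
    show "((\<lambda>h. \<bar>(f h - f 0) / h\<bar>) \<longlongrightarrow> 0) (at 0)"
      using lim by (rule tendsto_rabs_zero)
  qed
  with equal f'0 show ?thesis
    by (simp add: has_field_derivative_iff)
qed

lemma DERIV_profile:
  "(positive_part_profile has_real_derivative profile_deriv r) (at r)"
proof -
  have "((\<lambda>r::real. r - arctan r) has_real_derivative 1 - inverse (1 + r\<^sup>2)) (at r)" for r :: real
    by (auto intro!: derivative_eq_intros)
  from DERIV_max_zero[OF this] show ?thesis
    unfolding positive_part_profile_def profile_deriv_def by simp
qed

lemma DERIV_profile_deriv:
  "(profile_deriv has_real_derivative profile_deriv2 r) (at r)"
proof -
  have pos: "1 + r\<^sup>2 \<noteq> 0" for r :: real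
    using zero_le_power2[of r] by linarith
  have "((\<lambda>r::real. 1 - inverse (1 + r\<^sup>2)) has_real_derivative 2 * r * (inverse (1 + r\<^sup>2))\<^sup>2) (at r)"
    for r :: real
    using pos[of r] by (auto intro!: derivative_eq_intros simp: power2_eq_square field_simps)
  from DERIV_max_zero[OF this] show ?thesis
    unfolding profile_deriv2_def profile_deriv_def by simp
qed

lemma continuous_profile:
  "continuous_on UNIV positive_part_profile" "continuous_on UNIV profile_deriv"
  "continuous_on UNIV profile_deriv2"
proof -
  show "continuous_on UNIV positive_part_profile" "continuous_on UNIV profile_deriv"
    using DERIV_profile DERIV_profile_deriv by (metis DERIV_isCont continuous_at_imp_continuous_on)+
  have "1 + (max 0 r)\<^sup>2 \<noteq> 0" for r :: real
    using zero_le_power2[of "max 0 r"] by linarith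
  then show "continuous_on UNIV profile_deriv2"
    unfolding profile_deriv2_def by (intro continuous_intros) auto
qed

lemma profile_deriv_nonneg: "0 \<le> profile_deriv r" and profile_deriv2_nonneg: "0 \<le> profile_deriv2 r"
  unfolding profile_deriv_def profile_deriv2_def by (simp_all add: inverse_le_1_iff add_nonneg_nonneg)

lemma profile_deriv_nonpos_arg: "r \<le> 0 \<Longrightarrow> profile_deriv r = 0"
  unfolding profile_deriv_def by simp

lemma profile_nonneg: "0 \<le> positive_part_profile r"
  and profile_le: "positive_part_profile r \<le> max 0 r"
  unfolding positive_part_profile_def using arctan_le_self[of "max 0 r"] by simp_all

lemma profile_pos:
  assumes "0 < r"
  shows "0 < positive_part_profile r"
proof -
  have "positive_part_profile 0 < positive_part_profile r"
  proof (rule DERIV_pos_imp_increasing_open[OF assms])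
    fix x :: real assume "0 < x"
    then have "0 < profile_deriv x"
      unfolding profile_deriv_def by (simp add: inverse_less_1_iff)
    then show "\<exists>y. DERIV positive_part_profile x :> y \<and> 0 < y"
      using DERIV_profile by blast
  qed (use continuous_profile(1) in \<open>rule continuous_on_subset; simp\<close>)
  then show ?thesis by (simp add: positive_part_profile_def)
qed

section \<open>Integration over the torus\<close>

text \<open>
  The closed unit cube is used as fundamental domain since integration over compact boxes allows differentiation
  under the integral sign. It differs from the half-open cell by a null set.
\<close>

definition cell :: "(real ^ 'd) set" where
  "cell = cbox 0 One"

lemma integrable_on_cell:
  fixes f :: "real ^ 'd \<Rightarrow> real"
  shows "continuous_on UNIV f \<Longrightarrow> f integrable_on cell"
  unfolding cell_def by (rule integrable_continuous, rule continuous_on_subset) auto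

lemma One_nth: "(One :: real ^ 'd) $ j = 1"
proof -
  have "(One :: real ^ 'd) $ j = One \<bullet> axis j (1::real)" by (simp add: inner_axis)
  also have "\<dots> = (\<Sum>b\<in>Basis. if b = axis j (1::real) then 1 else 0)"
    unfolding inner_sum_left by (rule sum.cong) (auto simp: inner_Basis axis_in_Basis_iff)
  also have "\<dots> = 1" by (simp add: axis_in_Basis_iff)
  finally show ?thesis .
qed

lemma cell_representative:
  obtains y :: "real ^ 'd" where "y \<in> cell" "\<And>g. torus_fun g \<Longrightarrow> g y = g x"
proof
  let ?k = "(\<chi> i. - of_int \<lfloor>x $ i\<rfloor>) :: real ^ 'd"
  show "x + ?k \<in> cell"
    unfolding cell_def mem_box_cart by (auto simp: One_nth simp del: sum_component) linarith+
  show "g (x + ?k) = g x" if "torus_fun g" for g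
    using that unfolding torus_fun_def by auto
qed

text \<open>Cutting the shifted cell at the face of the original one and moving the part that sticks out back by a
  unit vector recovers the cell.\<close>

lemma integral_cell_translate:
  fixes f :: "real ^ 'd \<Rightarrow> real"
  assumes f: "continuous_on UNIV f" "torus_fun f" and h: "0 \<le> h" "h \<le> 1"
  shows "integral cell (\<lambda>x. f (x + h *\<^sub>R axis i 1)) = integral cell f"
proof -
  define e where "e = (axis i 1 :: real ^ 'd)"
  have eB: "e \<in> Basis" unfolding e_def by (simp add: axis_in_Basis_iff)
  have e_nth: "e $ j = (if j = i then 1 else 0)" for j
    unfolding e_def axis_def by auto
  have dot: "x \<bullet> e = x $ i" for x unfolding e_def by (simp add: inner_axis)
  have int: "f integrable_on cbox a b" for a b
    by (rule integrable_continuous) (use f(1) continuous_on_subset in blast)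
  have per: "f (x + e) = f x" for x
    using f(2) unfolding torus_fun_def by (auto simp: e_nth)
  have box: "x \<in> cbox (a *\<^sub>R e) (One + b *\<^sub>R e) \<longleftrightarrow>
      a \<le> x $ i \<and> x $ i \<le> 1 + b \<and> (\<forall>j. j \<noteq> i \<longrightarrow> 0 \<le> x $ j \<and> x $ j \<le> 1)" for a b x
  proof -
    have "x \<in> cbox (a *\<^sub>R e) (One + b *\<^sub>R e) \<longleftrightarrow>
        (\<forall>j. (if j = i then a else 0) \<le> x $ j \<and> x $ j \<le> 1 + (if j = i then b else 0))"
      unfolding mem_box_cart vector_add_component One_nth vector_scaleR_component
      by (simp only: e_nth) (rule iff_allI, simp)
    also have "\<dots> \<longleftrightarrow> a \<le> x $ i \<and> x $ i \<le> 1 + b \<and> (\<forall>j. j \<noteq> i \<longrightarrow> 0 \<le> x $ j \<and> x $ j \<le> 1)"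
      (is "?l \<longleftrightarrow> ?r")
    proof
      assume l: ?l
      have "0 \<le> x $ j \<and> x $ j \<le> 1" if "j \<noteq> i" for j
        using l[rule_format, of j] that by simp
      then show ?r using l[rule_format, of i] by simp
    qed simp
    finally show ?thesis .
  qed
  have box0: "x \<in> cbox 0 One \<longleftrightarrow> 0 \<le> x $ i \<and> x $ i \<le> 1 \<and> (\<forall>j. j \<noteq> i \<longrightarrow> 0 \<le> x $ j \<and> x $ j \<le> 1)" for x :: "real ^ 'd"
    using box[of x 0 0] by (simp only: scaleR_zero_left add_0_right)
  have box1: "x \<in> cbox e (One + h *\<^sub>R e) \<longleftrightarrow>
      1 \<le> x $ i \<and> x $ i \<le> 1 + h \<and> (\<forall>j. j \<noteq> i \<longrightarrow> 0 \<le> x $ j \<and> x $ j \<le> 1)" for x :: "real ^ 'd"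
    using box[of x 1 h] by (simp only: scaleR_one)
  have boxh: "x \<in> cbox 0 (One + (h *\<^sub>R e - e)) \<longleftrightarrow>
      0 \<le> x $ i \<and> x $ i \<le> h \<and> (\<forall>j. j \<noteq> i \<longrightarrow> 0 \<le> x $ j \<and> x $ j \<le> 1)" for x :: "real ^ 'd"
    using box[of x 0 "h - 1"] by (simp only: scaleR_zero_left scaleR_left_diff_distrib scaleR_one) simp
  have "integral cell (\<lambda>x. f (x + h *\<^sub>R e)) = integral (cbox (h *\<^sub>R e) (One + h *\<^sub>R e)) f"
    using integral_shift_cbox[of "h *\<^sub>R e" "h *\<^sub>R e" "One + h *\<^sub>R e" f] by (simp add: cell_def)
  also have "\<dots> = integral (cbox (h *\<^sub>R e) (One + h *\<^sub>R e) \<inter> {x. x \<bullet> e \<le> 1}) f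
      + integral (cbox (h *\<^sub>R e) (One + h *\<^sub>R e) \<inter> {x. x \<bullet> e \<ge> 1}) f"
    by (rule integral_split[OF int eB])
  also have "cbox (h *\<^sub>R e) (One + h *\<^sub>R e) \<inter> {x. x \<bullet> e \<le> 1} = cbox 0 One \<inter> {x. x \<bullet> e \<ge> h}"
    by (intro set_eqI, unfold Int_iff mem_Collect_eq box box0 dot) (use h in auto)
  also have "cbox (h *\<^sub>R e) (One + h *\<^sub>R e) \<inter> {x. x \<bullet> e \<ge> 1} = cbox e (One + h *\<^sub>R e)"
    by (intro set_eqI, unfold Int_iff mem_Collect_eq box box1 dot) (use h in auto)
  also have "integral (cbox e (One + h *\<^sub>R e)) f = integral (cbox 0 (One + (h *\<^sub>R e - e))) f"
    using integral_shift_cbox[of e e "One + h *\<^sub>R e" f] by (simp add: per add_diff_eq)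
  also have "cbox 0 (One + (h *\<^sub>R e - e)) = cbox 0 One \<inter> {x. x \<bullet> e \<le> h}"
    by (intro set_eqI, unfold Int_iff mem_Collect_eq boxh box0 dot) (use h in auto)
  also have "integral (cbox 0 One \<inter> {x. x \<bullet> e \<ge> h}) f + integral (cbox 0 One \<inter> {x. x \<bullet> e \<le> h}) f
      = integral (cbox 0 One) f"
    using integral_split[OF int eB, of 0 One h] by simp
  finally show ?thesis unfolding e_def cell_def .
qed

text \<open>
  This replaces integration by parts on the torus. The integral of \<open>g\<close> over the translated cell is independent of
  the translation, so its derivative in the direction of the translation, which is the integral of the partial
  derivative, vanishes.
\<close>

lemma integral_cell_partial_deriv_eq_0:
  fixes g g' :: "real ^ 'd \<Rightarrow> real"
  assumes g: "continuous_on UNIV g" "torus_fun g" and g': "continuous_on UNIV g'" "torus_fun g'"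
    and der: "\<And>x. ((\<lambda>h. g (x + h *\<^sub>R axis i 1)) has_real_derivative g' x) (at 0)"
  shows "integral cell g' = 0"
proof -
  let ?e = "axis i 1 :: real ^ 'd"
  have der': "((\<lambda>h. g (x + h *\<^sub>R ?e)) has_real_derivative g' (x + h0 *\<^sub>R ?e)) (at h0)" for x h0
    using der[of "x + h0 *\<^sub>R ?e"] DERIV_shift[of "\<lambda>h. g (x + h *\<^sub>R ?e)" "g' (x + h0 *\<^sub>R ?e)" 0 h0]
    by (simp add: algebra_simps)
  let ?U = "{0<..<1} :: real set"
  have open_at: "at (1/2) within ?U = at (1/2)"
    by (rule at_within_open) auto
  \<comment> \<open>The derivative is taken at the interior point 1/2 because translation invariance is known for shifts in [0, 1].\<close>
  have "((\<lambda>h. integral cell (\<lambda>x. g (x + h *\<^sub>R ?e))) has_real_derivative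
      integral cell (\<lambda>x. g' (x + (1/2) *\<^sub>R ?e))) (at (1/2) within ?U)"
    unfolding cell_def
  proof (rule leibniz_rule_field_derivative)
    show "continuous_on (?U \<times> cbox 0 One) (\<lambda>(h, x). g' (x + h *\<^sub>R ?e))"
      unfolding case_prod_beta
      by (intro continuous_on_compose2[OF g'(1)] continuous_intros) auto
    show "(\<lambda>x. g (x + h *\<^sub>R ?e)) integrable_on cbox 0 One" for h
      by (intro integrable_continuous continuous_on_compose2[OF g(1)] continuous_intros) auto
  qed (use der' in \<open>auto intro: has_field_derivative_at_within\<close>)
  moreover have "((\<lambda>h. integral cell (\<lambda>x. g (x + h *\<^sub>R ?e))) has_real_derivative 0) (at (1/2) within ?U)"
  proof (rule has_field_derivative_transform_within[where d = 1])
    show "((\<lambda>h. integral cell g) has_real_derivative 0) (at (1/2) within ?U)" by simp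
  qed (use integral_cell_translate[OF g] in auto)
  ultimately have "integral cell (\<lambda>x. g' (x + (1/2) *\<^sub>R ?e)) = 0"
    unfolding open_at by (rule DERIV_unique)
  then show ?thesis
    using integral_cell_translate[OF g', of "1/2" i] by simp
qed

section \<open>The comparison principle for the heat equation on the torus\<close>

text \<open>
  The derivatives entering the heat operator are recorded as explicit functions, so that linear operations on solutions
  and on their equations can be carried out without re-establishing differentiability.
\<close>

definition parabolic_jet ::
  "(real \<times> (real ^ 'd) \<Rightarrow> real) \<Rightarrow> (real \<times> (real ^ 'd) \<Rightarrow> real) \<Rightarrow>
    ('d \<Rightarrow> real \<times> (real ^ 'd) \<Rightarrow> real) \<Rightarrow> ('d \<Rightarrow> real \<times> (real ^ 'd) \<Rightarrow> real) \<Rightarrow> bool" where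
  "parabolic_jet v vt vx vxx \<longleftrightarrow>
     continuous_on ({0<..} \<times> UNIV) v \<and> continuous_on ({0<..} \<times> UNIV) vt \<and>
     (\<forall>i. continuous_on ({0<..} \<times> UNIV) (vx i)) \<and> (\<forall>i. continuous_on ({0<..} \<times> UNIV) (vxx i)) \<and>
     (\<forall>t>0. \<forall>x. ((\<lambda>s. v (s, x)) has_real_derivative vt (t, x)) (at t)) \<and>
     (\<forall>t>0. \<forall>x i. ((\<lambda>h. v (t, x + h *\<^sub>R axis i 1)) has_real_derivative vx i (t, x)) (at 0)) \<and>
     (\<forall>t>0. \<forall>x i. ((\<lambda>h. vx i (t, x + h *\<^sub>R axis i 1)) has_real_derivative vxx i (t, x)) (at 0))"

lemma parabolic_jet_diff:
  assumes "parabolic_jet v vt vx vxx" "parabolic_jet w wt wx wxx"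
  shows "parabolic_jet (\<lambda>z. v z - w z) (\<lambda>z. vt z - wt z) (\<lambda>i z. vx i z - wx i z) (\<lambda>i z. vxx i z - wxx i z)"
  unfolding parabolic_jet_def
  by (intro conjI allI impI continuous_on_diff DERIV_diff) (use assms in \<open>simp_all add: parabolic_jet_def\<close>)

lemma parabolic_jet_minus:
  assumes "parabolic_jet v vt vx vxx"
  shows "parabolic_jet (\<lambda>z. - v z) (\<lambda>z. - vt z) (\<lambda>i z. - vx i z) (\<lambda>i z. - vxx i z)"
  unfolding parabolic_jet_def
  by (intro conjI allI impI continuous_on_minus DERIV_minus) (use assms in \<open>simp_all add: parabolic_jet_def\<close>)

lemma parabolic_jet_time:
  assumes "\<And>t. (p has_real_derivative p' t) (at t)" "continuous_on UNIV p'"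
  shows "parabolic_jet (\<lambda>z. p (fst z)) (\<lambda>z. p' (fst z)) (\<lambda>i z. 0) (\<lambda>i z. 0)"
proof -
  have "continuous_on UNIV p"
    using assms(1) by (metis DERIV_isCont continuous_at_imp_continuous_on)
  with assms show ?thesis
    unfolding parabolic_jet_def
    by (auto intro!: continuous_on_compose2[of UNIV _ _ fst] continuous_intros)
qed

text \<open>
  Multiplication by \<open>exp (- L t)\<close> removes a zeroth-order term \<open>L v\<close> from a parabolic inequality.
\<close>

lemma parabolic_jet_exp_mult:
  assumes "parabolic_jet v vt vx vxx"
  shows "parabolic_jet (\<lambda>z. exp (- L * fst z) * v z) (\<lambda>z. exp (- L * fst z) * (vt z - L * v z))
    (\<lambda>i z. exp (- L * fst z) * vx i z) (\<lambda>i z. exp (- L * fst z) * vxx i z)"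
proof -
  have exp_der: "((\<lambda>s. exp (- L * s)) has_real_derivative exp (- L * t) * (- L)) (at t)" for t
    by (auto intro!: derivative_eq_intros)
  have "((\<lambda>s. exp (- L * s) * v (s, x)) has_real_derivative exp (- L * t) * (vt (t, x) - L * v (t, x))) (at t)"
    if "0 < t" for t x
  proof -
    have "((\<lambda>s. v (s, x)) has_real_derivative vt (t, x)) (at t)"
      using that assms unfolding parabolic_jet_def by blast
    from DERIV_mult[OF exp_der this] show ?thesis by (simp add: algebra_simps)
  qed
  then show ?thesis
    using assms unfolding parabolic_jet_def
    by (auto intro!: continuous_intros DERIV_cmult)
qed

lemma parabolic_jet_slice:
  assumes "parabolic_jet v vt vx vxx" "0 < t"
  shows "continuous_on UNIV (\<lambda>x. v (t, x))" "continuous_on UNIV (\<lambda>x. vt (t, x))"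
    "continuous_on UNIV (\<lambda>x. vx i (t, x))" "continuous_on UNIV (\<lambda>x. vxx i (t, x))"
proof -
  have slice: "continuous_on UNIV (\<lambda>x. g (t, x))" if "continuous_on ({0<..} \<times> UNIV) g"
    for g :: "real \<times> (real ^ 'a) \<Rightarrow> real"
    by (rule continuous_on_compose2[OF that, where f = "\<lambda>x. (t, x)"])
      (use assms(2) in \<open>auto intro: continuous_intros\<close>)
  show "continuous_on UNIV (\<lambda>x. v (t, x))" "continuous_on UNIV (\<lambda>x. vt (t, x))"
    "continuous_on UNIV (\<lambda>x. vx i (t, x))" "continuous_on UNIV (\<lambda>x. vxx i (t, x))"
    using assms(1) slice unfolding parabolic_jet_def by blast+
qed

lemma parabolic_jet_periodic:
  assumes jet: "parabolic_jet v vt vx vxx" and per: "\<And>t. 0 < t \<Longrightarrow> torus_fun (\<lambda>x. v (t, x))" and t: "0 < t"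
  shows "torus_fun (\<lambda>x. vx i (t, x))" "torus_fun (\<lambda>x. vxx i (t, x))"
proof -
  have shift: "g (t, x + k + h *\<^sub>R axis i 1) = g (t, x + h *\<^sub>R axis i 1)"
    if "torus_fun (\<lambda>x. g (t, x))" "\<forall>i. k $ i \<in> \<int>" for x k h and g :: "real \<times> (real ^ 'a) \<Rightarrow> real"
  proof -
    have eq: "x + k + h *\<^sub>R axis i 1 = (x + h *\<^sub>R axis i 1) + k" by (simp add: algebra_simps)
    show ?thesis using that unfolding eq torus_fun_def by blast
  qed
  show *: "torus_fun (\<lambda>x. vx i (t, x))"
    unfolding torus_fun_def
  proof (intro allI impI)
    fix x k :: "real ^ 'a" assume k: "\<forall>i. k $ i \<in> \<int>"
    have "((\<lambda>h. v (t, y + h *\<^sub>R axis i 1)) has_real_derivative vx i (t, y)) (at 0)" for y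
      using jet t unfolding parabolic_jet_def by blast
    from this[of x] this[of "x + k"] show "vx i (t, x + k) = vx i (t, x)"
      unfolding shift[of v, OF per[OF t] k] by (rule DERIV_unique[rotated])
  qed
  show "torus_fun (\<lambda>x. vxx i (t, x))"
    unfolding torus_fun_def
  proof (intro allI impI)
    fix x k :: "real ^ 'a" assume k: "\<forall>i. k $ i \<in> \<int>"
    have "((\<lambda>h. vx i (t, y + h *\<^sub>R axis i 1)) has_real_derivative vxx i (t, y)) (at 0)" for y
      using jet t unfolding parabolic_jet_def by blast
    from this[of x] this[of "x + k"] show "vxx i (t, x + k) = vxx i (t, x)"
      unfolding shift[of "vx i", OF * k] by (rule DERIV_unique[rotated])
  qed
qed

text \<open>
  For \<open>\<beta>\<close> convex, \<open>\<partial>\<^sub>i(\<beta>'(v) \<partial>\<^sub>iv) = \<beta>''(v) (\<partial>\<^sub>iv)\<^sup>2 + \<beta>'(v) \<partial>\<^sub>i\<partial>\<^sub>iv\<close> has vanishing integral and its first term is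
  nonnegative.
\<close>

lemma integral_profile_deriv_laplacian_nonpos:
  assumes jet: "parabolic_jet v vt vx vxx" and per: "\<And>t. 0 < t \<Longrightarrow> torus_fun (\<lambda>x. v (t, x))" and t: "0 < t"
  shows "integral cell (\<lambda>x. profile_deriv (v (t, x)) * vxx i (t, x)) \<le> 0"
proof -
  let ?p1 = "\<lambda>x. profile_deriv (v (t, x))" and ?p2 = "\<lambda>x. profile_deriv2 (v (t, x))"
  note cont = parabolic_jet_slice[OF jet t]
  have cp: "continuous_on UNIV ?p1" "continuous_on UNIV ?p2"
    using cont(1) continuous_profile by (auto intro: continuous_on_compose2)
  let ?rest = "\<lambda>x. ?p2 x * vx i (t, x) * vx i (t, x)"
  have per': "torus_fun (\<lambda>x. v (t, x))" "torus_fun (\<lambda>x. vx i (t, x))" "torus_fun (\<lambda>x. vxx i (t, x))"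
    using per[OF t] parabolic_jet_periodic[OF jet per t] by auto
  have int: "(\<lambda>x. ?p1 x * vxx i (t, x)) integrable_on cell" "?rest integrable_on cell"
    by (intro integrable_on_cell continuous_on_mult cp cont)+
  have "integral cell (\<lambda>x. ?rest x + ?p1 x * vxx i (t, x)) = 0"
  proof (rule integral_cell_partial_deriv_eq_0)
    show "continuous_on UNIV (\<lambda>x. ?p1 x * vx i (t, x))" "continuous_on UNIV (\<lambda>x. ?rest x + ?p1 x * vxx i (t, x))"
      by (intro continuous_on_mult continuous_on_add cp cont)+
    show "torus_fun (\<lambda>x. ?p1 x * vx i (t, x))" "torus_fun (\<lambda>x. ?rest x + ?p1 x * vxx i (t, x))"
      using per' unfolding torus_fun_def by auto
    fix x
    have "((\<lambda>h. v (t, x + h *\<^sub>R axis i 1)) has_real_derivative vx i (t, x)) (at 0)"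
      "((\<lambda>h. vx i (t, x + h *\<^sub>R axis i 1)) has_real_derivative vxx i (t, x)) (at 0)"
      using jet t unfolding parabolic_jet_def by blast+
    from DERIV_mult[OF DERIV_chain2[OF DERIV_profile_deriv this(1)] this(2)]
    show "((\<lambda>h. ?p1 (x + h *\<^sub>R axis i 1) * vx i (t, x + h *\<^sub>R axis i 1)) has_real_derivative
        ?rest x + ?p1 x * vxx i (t, x)) (at 0)"
      by (simp add: algebra_simps)
  qed
  then have "integral cell (\<lambda>x. ?p1 x * vxx i (t, x)) = - integral cell ?rest"
    using int by (simp add: integral_add)
  moreover have "0 \<le> integral cell ?rest"
    using int(2) by (intro integral_nonneg) (auto simp: profile_deriv2_nonneg mult.assoc)
  ultimately show ?thesis by simp
qed

text \<open>
  The integral \<open>E t\<close> of \<open>\<beta>(v t)\<close> has derivative \<open>\<integral> \<beta>'(v) \<partial>\<^sub>tv \<le> \<integral> \<beta>'(v) \<Delta>v \<le> 0\<close>; as \<open>\<beta>'\<close> vanishes on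
  the negative axis, an inequality on the set \<open>v > 0\<close> suffices. Since \<open>\<beta>\<close> is at most the positive part, \<open>E\<close> tends to
  \<open>0\<close> at the initial time, hence \<open>E = 0\<close>, and continuity of \<open>v\<close> turns this into a pointwise statement.
\<close>

lemma subsolution_nonpos:
  assumes jet: "parabolic_jet v vt vx vxx" and per: "\<And>t. 0 < t \<Longrightarrow> torus_fun (\<lambda>x. v (t, x))"
    and t0: "0 \<le> t0"
    and sub: "\<And>t x. t0 < t \<Longrightarrow> t \<le> t1 \<Longrightarrow> 0 < v (t, x) \<Longrightarrow> vt (t, x) \<le> (\<Sum>i\<in>UNIV. vxx i (t, x))"
    and init: "((\<lambda>t. integral cell (\<lambda>x. max 0 (v (t, x)))) \<longlongrightarrow> 0) (at_right t0)"
    and t: "t0 < t" "t \<le> t1"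
  shows "v (t, x) \<le> 0"
proof -
  define E where "E = (\<lambda>t. integral cell (\<lambda>x. positive_part_profile (v (t, x))))"
  define E' where "E' = (\<lambda>t. integral cell (\<lambda>x. profile_deriv (v (t, x)) * vt (t, x)))"
  note cont = parabolic_jet_slice[OF jet]
  have cp: "continuous_on UNIV (\<lambda>x. profile_deriv (v (s, x)))"
    "continuous_on UNIV (\<lambda>x. positive_part_profile (v (s, x)))" if "0 < s" for s
    by (rule continuous_on_compose2[OF continuous_profile(2) cont(1)[OF that] subset_UNIV],
        rule continuous_on_compose2[OF continuous_profile(1) cont(1)[OF that] subset_UNIV])
  have int_E: "(\<lambda>x. positive_part_profile (v (s, x))) integrable_on cell" if "0 < s" for s
    by (intro integrable_on_cell cp that)
  have "(E has_real_derivative E' s) (at s within {0<..})" if s: "0 < s" for s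
    unfolding E_def E'_def cell_def
  proof (rule leibniz_rule_field_derivative)
    fix r :: real and x assume "r \<in> {0<..}"
    then have "((\<lambda>s. v (s, x)) has_real_derivative vt (r, x)) (at r)"
      using jet unfolding parabolic_jet_def by auto
    from DERIV_chain2[OF DERIV_profile this]
    show "((\<lambda>s. positive_part_profile (v (s, x))) has_real_derivative profile_deriv (v (r, x)) * vt (r, x)) (at r within {0<..})"
      by (rule has_field_derivative_at_within)
  next
    have "continuous_on ({0<..} \<times> UNIV) v" "continuous_on ({0<..} \<times> UNIV) vt"
      using jet unfolding parabolic_jet_def by auto
    then have "continuous_on ({0<..} \<times> UNIV) (\<lambda>z. profile_deriv (v z) * vt z)"
      by (intro continuous_on_mult continuous_on_compose2[OF continuous_profile(2)]) auto
    then show "continuous_on ({0<..} \<times> cbox 0 One) (\<lambda>(s, x). profile_deriv (v (s, x)) * vt (s, x))"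
      by (simp add: case_prod_beta) (rule continuous_on_subset, auto)
  qed (use s int_E[unfolded cell_def] in auto)
  then have E_der: "(E has_real_derivative E' s) (at s)" if "0 < s" for s
    using that at_within_open[of s "{0<..}"] by (metis greaterThan_iff open_greaterThan)
  have E'_nonpos: "E' s \<le> 0" if s: "t0 < s" "s \<le> t1" for s
  proof -
    have s0: "0 < s" using s t0 by simp
    have int: "(\<lambda>x. profile_deriv (v (s, x)) * vxx i (s, x)) integrable_on cell" for i
      by (intro integrable_on_cell continuous_on_mult cp cont s0)
    have "E' s \<le> integral cell (\<lambda>x. \<Sum>i\<in>UNIV. profile_deriv (v (s, x)) * vxx i (s, x))"
      unfolding E'_def
    proof (rule integral_le)
      show "(\<lambda>x. profile_deriv (v (s, x)) * vt (s, x)) integrable_on cell"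
        by (intro integrable_on_cell continuous_on_mult cp cont s0)
      show "(\<lambda>x. \<Sum>i\<in>UNIV. profile_deriv (v (s, x)) * vxx i (s, x)) integrable_on cell"
        using int by (intro integrable_sum) auto
      show "profile_deriv (v (s, x)) * vt (s, x) \<le> (\<Sum>i\<in>UNIV. profile_deriv (v (s, x)) * vxx i (s, x))" for x
        unfolding sum_distrib_left[symmetric]
      proof (cases "0 < v (s, x)")
        case True
        then show "profile_deriv (v (s, x)) * vt (s, x) \<le> profile_deriv (v (s, x)) * (\<Sum>i\<in>UNIV. vxx i (s, x))"
          using sub[OF s] profile_deriv_nonneg by (intro mult_left_mono) auto
      qed (simp add: profile_deriv_nonpos_arg)
    qed
    also have "\<dots> = (\<Sum>i\<in>UNIV. integral cell (\<lambda>x. profile_deriv (v (s, x)) * vxx i (s, x)))"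
      using int by (intro integral_sum) auto
    also have "\<dots> \<le> 0"
      by (intro sum_nonpos integral_profile_deriv_laplacian_nonpos[OF jet per s0])
    finally show ?thesis .
  qed
  have t_pos: "0 < t" using t t0 by simp
  have "E t \<le> 0"
  proof (rule tendsto_lowerbound[OF init])
    show "\<forall>\<^sub>F s in at_right t0. E t \<le> integral cell (\<lambda>x. max 0 (v (s, x)))"
      unfolding eventually_at_right_field
    proof (intro exI[of _ t] conjI allI impI t)
      fix s assume s: "t0 < s" "s < t"
      then have s0: "0 < s" using t0 by simp
      have "E t \<le> E s"
      proof (rule DERIV_nonpos_imp_nonincreasing[of s t E])
        fix r assume "s \<le> r" "r \<le> t"
        then show "\<exists>y. DERIV E r :> y \<and> y \<le> 0"
          using E_der[of r] E'_nonpos[of r] s t t0 by auto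
      qed (use s in simp)
      also have "E s \<le> integral cell (\<lambda>x. max 0 (v (s, x)))"
        unfolding E_def
        by (intro integral_le int_E s0 integrable_on_cell continuous_on_max continuous_on_const
            cont(1) profile_le)
      finally show "E t \<le> integral cell (\<lambda>x. max 0 (v (s, x)))" .
    qed
  qed simp
  moreover have "0 \<le> E t"
    unfolding E_def by (intro integral_nonneg int_E t_pos profile_nonneg)
  ultimately have "integral (cbox 0 One) (\<lambda>x. positive_part_profile (v (t, x))) = 0"
    unfolding E_def cell_def by simp
  moreover obtain y where "y \<in> cell" and rep: "\<And>g. torus_fun g \<Longrightarrow> g y = g x"
    by (rule cell_representative[of x]) blast
  ultimately have "positive_part_profile (v (t, y)) = 0"
    using integral_cbox_eq_0_iff[of "0 :: real ^ 'a" One "\<lambda>x. positive_part_profile (v (t, x))"]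
      continuous_on_subset[OF cp(2)[OF t_pos] subset_UNIV] profile_nonneg
    unfolding cell_def by (auto simp: box_eq_empty)
  then show ?thesis
    using rep[OF per[OF t_pos]] profile_pos[of "v (t, x)"] by force
qed

lemma subsolution_nonpos_linear:
  assumes jet: "parabolic_jet v vt vx vxx" and per: "\<And>t. 0 < t \<Longrightarrow> torus_fun (\<lambda>x. v (t, x))"
    and t0: "0 \<le> t0"
    and sub: "\<And>t x. t0 < t \<Longrightarrow> t \<le> t1 \<Longrightarrow> 0 < v (t, x) \<Longrightarrow>
      vt (t, x) \<le> (\<Sum>i\<in>UNIV. vxx i (t, x)) + L * v (t, x)"
    and init: "((\<lambda>t. integral cell (\<lambda>x. max 0 (v (t, x)))) \<longlongrightarrow> 0) (at_right t0)"
    and t: "t0 < t" "t \<le> t1"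
  shows "v (t, x) \<le> 0"
proof -
  have "exp (- L * fst (t, x)) * v (t, x) \<le> 0"
  proof (rule subsolution_nonpos[OF parabolic_jet_exp_mult[OF jet, of L] _ t0 _ _ t])
    show "torus_fun (\<lambda>x. exp (- L * fst (s, x)) * v (s, x))" if "0 < s" for s
      using per[OF that] unfolding torus_fun_def by simp
    show "exp (- L * fst (s, x)) * (vt (s, x) - L * v (s, x)) \<le> (\<Sum>i\<in>UNIV. exp (- L * fst (s, x)) * vxx i (s, x))"
      if "t0 < s" "s \<le> t1" "0 < exp (- L * fst (s, x)) * v (s, x)" for s x
      using sub[of s x] that unfolding sum_distrib_left[symmetric]
      by (intro mult_left_mono) (auto simp: zero_less_mult_iff)
    have "((\<lambda>s. exp (- L * s) * integral cell (\<lambda>x. max 0 (v (s, x)))) \<longlongrightarrow> exp (- L * t0) * 0) (at_right t0)"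
      by (intro tendsto_intros init)
    moreover have "exp (- L * s) * integral cell (\<lambda>x. max 0 (v (s, x))) =
        integral cell (\<lambda>x. max 0 (exp (- L * fst (s, x)) * v (s, x)))" for s
      by (simp add: max_mult_distrib_left flip: integral_mult_right)
    ultimately show "((\<lambda>s. integral cell (\<lambda>x. max 0 (exp (- L * fst (s, x)) * v (s, x)))) \<longlongrightarrow> 0) (at_right t0)"
      by simp
  qed
  then show ?thesis by (simp add: mult_le_0_iff)
qed

section \<open>Comparison of solutions of semilinear equations\<close>

definition classical_solution ::
  "real \<Rightarrow> (real \<times> (real ^ 'd) \<Rightarrow> real \<Rightarrow> real) \<Rightarrow> (real \<times> (real ^ 'd) \<Rightarrow> real) \<Rightarrow> bool" where
  "classical_solution m G v \<longleftrightarrow>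
     (\<forall>t>0. torus_fun (\<lambda>x. v (t, x))) \<and>
     (\<exists>vt vx vxx. parabolic_jet v vt vx vxx \<and>
       (\<forall>t>0. \<forall>x. vt (t, x) - (\<Sum>i\<in>UNIV. vxx i (t, x)) + m\<^sup>2 * v (t, x) = G (t, x) (v (t, x))))"

lemma classical_solution_minus:
  assumes "classical_solution m G v"
  shows "classical_solution m (\<lambda>z b. - G z (- b)) (\<lambda>z. - v z)"
proof -
  obtain vt vx vxx where jet: "parabolic_jet v vt vx vxx"
    and eq: "\<And>t x. 0 < t \<Longrightarrow> vt (t, x) - (\<Sum>i\<in>UNIV. vxx i (t, x)) + m\<^sup>2 * v (t, x) = G (t, x) (v (t, x))"
    using assms unfolding classical_solution_def by blast
  have "- vt (t, x) - (\<Sum>i\<in>UNIV. - vxx i (t, x)) + m\<^sup>2 * (- v (t, x)) = - G (t, x) (- (- v (t, x)))"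
    if "0 < t" for t x
    using eq[OF that, of x] by (simp add: sum_negf)
  moreover have "torus_fun (\<lambda>x. - v (t, x))" if "0 < t" for t
    using assms that unfolding classical_solution_def torus_fun_def by simp
  ultimately show ?thesis
    unfolding classical_solution_def using parabolic_jet_minus[OF jet] by blast
qed

lemma classical_solution_slice:
  assumes "classical_solution m G v" "0 < t"
  shows "continuous_on UNIV (\<lambda>x. v (t, x))"
  using assms parabolic_jet_slice(1) unfolding classical_solution_def by blast

lemma classical_solution_continuous:
  assumes "classical_solution m G v"
  shows "continuous_on ({0<..} \<times> UNIV) v"
  using assms unfolding classical_solution_def parabolic_jet_def by blast

text \<open>
  Comparison with \<open>A + M t\<close>. The mass term has the good sign where \<open>u\<close> exceeds this nonnegative function.
\<close>

lemma comparison_bounded_rhs: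
  fixes u :: "real \<times> (real ^ 'd) \<Rightarrow> real"
  assumes u: "classical_solution m G u" and G: "\<And>t x b. 0 < t \<Longrightarrow> G (t, x) b \<le> M"
    and A: "0 \<le> A" and M: "0 \<le> M"
    and init: "((\<lambda>t. integral cell (\<lambda>x. max 0 (u (t, x) - A))) \<longlongrightarrow> 0) (at_right 0)"
    and t: "0 < t"
  shows "u (t, x) \<le> A + M * t"
proof -
  obtain ut ux uxx where jet: "parabolic_jet u ut ux uxx"
    and eq: "\<And>t x. 0 < t \<Longrightarrow> ut (t, x) - (\<Sum>i\<in>UNIV. uxx i (t, x)) + m\<^sup>2 * u (t, x) = G (t, x) (u (t, x))"
    and per: "\<And>t. 0 < t \<Longrightarrow> torus_fun (\<lambda>x. u (t, x))"
    using u unfolding classical_solution_def by blast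
  have time: "parabolic_jet (\<lambda>z. A + M * fst z) (\<lambda>z. M) (\<lambda>(i :: 'd) z. 0) (\<lambda>i z. 0)"
    by (rule parabolic_jet_time[of "\<lambda>t. A + M * t" "\<lambda>t. M"]) (auto intro!: derivative_eq_intros)
  let ?v = "\<lambda>z. u z - (A + M * fst z)"
  have "?v (t, x) \<le> 0"
  proof (rule subsolution_nonpos[OF parabolic_jet_diff[OF jet time] _ order_refl _ _ t order_refl])
    show "torus_fun (\<lambda>x. ?v (s, x))" if "0 < s" for s
      using per[OF that] unfolding torus_fun_def by simp
    show "ut (s, x) - M \<le> (\<Sum>i\<in>UNIV. uxx i (s, x) - 0)" if s: "0 < s" and v: "0 < ?v (s, x)" for s x
    proof -
      have "0 \<le> M * s" using M s by simp
      then have "0 \<le> u (s, x)" using v A by simp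
      then have "0 \<le> m\<^sup>2 * u (s, x)" by simp
      with eq[OF s, of x] G[OF s, of x "u (s, x)"] show ?thesis by simp
    qed
    show "((\<lambda>s. integral cell (\<lambda>x. max 0 (?v (s, x)))) \<longlongrightarrow> 0) (at_right 0)"
    proof (rule tendsto_sandwich[OF _ _ tendsto_const init])
      have int: "(\<lambda>x. max 0 (u (s, x) - c)) integrable_on cell" if "0 < s" for s c
        by (intro integrable_on_cell continuous_on_max continuous_on_diff continuous_on_const
            classical_solution_slice[OF u that])
      show "\<forall>\<^sub>F s in at_right 0. 0 \<le> integral cell (\<lambda>x. max 0 (?v (s, x)))"
        unfolding eventually_at_right_field
        by (intro exI[of _ 1] conjI allI impI integral_nonneg) (use int in auto)
      show "\<forall>\<^sub>F s in at_right 0. integral cell (\<lambda>x. max 0 (?v (s, x))) \<le> integral cell (\<lambda>x. max 0 (u (s, x) - A))"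
        unfolding eventually_at_right_field
      proof (intro exI[of _ 1] conjI allI impI)
        fix s :: real assume s: "0 < s"
        have "0 \<le> M * s" using M s by simp
        then show "integral cell (\<lambda>x. max 0 (?v (s, x))) \<le> integral cell (\<lambda>x. max 0 (u (s, x) - A))"
          using int[OF s] by (intro integral_le) auto
      qed simp
    qed
  qed
  then show ?thesis by simp
qed

text \<open>
  The difference \<open>v = u - w - c (t1 - t)\<close> satisfies \<open>\<partial>\<^sub>tv - \<Delta>v \<le> L v + L c (t1 - t) + c - m\<^sup>2 a\<close> where it is positive:
  the surplus \<open>m\<^sup>2 a\<close> in the equation for \<open>w\<close> has to pay for the decrease of the affine correction and for its effect on
  the nonlinearity. The correction itself is what allows \<open>u\<close> to exceed \<open>w\<close> by \<open>c (t1 - t0)\<close> at the initial time.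
\<close>

lemma comparison_with_barrier:
  fixes u w :: "real \<times> (real ^ 'd) \<Rightarrow> real"
  assumes u: "classical_solution m f u" and w: "classical_solution m (\<lambda>z b. m\<^sup>2 * a + f z b) w"
    and t0: "0 \<le> t0" and L: "0 \<le> L" and c: "0 \<le> c"
    and lip: "\<And>t x. t0 < t \<Longrightarrow> t \<le> t1 \<Longrightarrow>
      \<bar>f (t, x) (u (t, x)) - f (t, x) (w (t, x))\<bar> \<le> L * \<bar>u (t, x) - w (t, x)\<bar>"
    and slack: "c * (1 + L * (t1 - t0)) \<le> m\<^sup>2 * a"
    and init: "((\<lambda>t. integral cell (\<lambda>x. max 0 (u (t, x) - w (t, x) - c * (t1 - t)))) \<longlongrightarrow> 0) (at_right t0)"
    and t: "t0 < t" "t \<le> t1"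
  shows "u (t, x) \<le> w (t, x) + c * (t1 - t)"
proof -
  obtain ut ux uxx where jetu: "parabolic_jet u ut ux uxx"
    and equ: "\<And>t x. 0 < t \<Longrightarrow> ut (t, x) - (\<Sum>i\<in>UNIV. uxx i (t, x)) + m\<^sup>2 * u (t, x) = f (t, x) (u (t, x))"
    and peru: "\<And>t. 0 < t \<Longrightarrow> torus_fun (\<lambda>x. u (t, x))"
    using u unfolding classical_solution_def by blast
  obtain wt wx wxx where jetw: "parabolic_jet w wt wx wxx"
    and eqw: "\<And>t x. 0 < t \<Longrightarrow>
      wt (t, x) - (\<Sum>i\<in>UNIV. wxx i (t, x)) + m\<^sup>2 * w (t, x) = m\<^sup>2 * a + f (t, x) (w (t, x))"
    and perw: "\<And>t. 0 < t \<Longrightarrow> torus_fun (\<lambda>x. w (t, x))"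
    using w unfolding classical_solution_def by blast
  have time: "parabolic_jet (\<lambda>z. c * (t1 - fst z)) (\<lambda>z. - c) (\<lambda>(i :: 'd) z. 0) (\<lambda>i z. 0)"
    by (rule parabolic_jet_time[of "\<lambda>t. c * (t1 - t)" "\<lambda>t. - c"]) (auto intro!: derivative_eq_intros)
  let ?v = "\<lambda>z. u z - w z - c * (t1 - fst z)"
  have "?v (t, x) \<le> 0"
  proof (rule subsolution_nonpos_linear[where L = L,
        OF parabolic_jet_diff[OF parabolic_jet_diff[OF jetu jetw] time] _ t0 _ _ t])
    show "torus_fun (\<lambda>x. ?v (s, x))" if "0 < s" for s
      using peru[OF that] perw[OF that] unfolding torus_fun_def by simp
    show "ut (s, x) - wt (s, x) - - c \<le> (\<Sum>i\<in>UNIV. uxx i (s, x) - wxx i (s, x) - 0) + L * ?v (s, x)"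
      if s: "t0 < s" "s \<le> t1" and v: "0 < ?v (s, x)" for s x
    proof -
      have s0: "0 < s" using s t0 by simp
      have e: "0 \<le> c * (t1 - s)" using c s by simp
      then have uw: "0 \<le> u (s, x) - w (s, x)" using v by simp
      have "L * (c * (t1 - s)) \<le> L * (c * (t1 - t0))"
        using L c s by (intro mult_left_mono) auto
      moreover have "0 \<le> m\<^sup>2 * (u (s, x) - w (s, x))" using uw by simp
      moreover have "f (s, x) (u (s, x)) - f (s, x) (w (s, x)) \<le> L * (u (s, x) - w (s, x))"
        using lip[OF s, of x] uw by simp
      moreover have "L * ?v (s, x) = L * (u (s, x) - w (s, x)) - L * (c * (t1 - s))"
        by (simp add: algebra_simps)
      ultimately show ?thesis
        using equ[OF s0, of x] eqw[OF s0, of x] slack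
        by (simp add: sum_subtractf algebra_simps)
    qed
    show "((\<lambda>s. integral cell (\<lambda>x. max 0 (?v (s, x)))) \<longlongrightarrow> 0) (at_right t0)"
      using init by simp
  qed
  then show ?thesis by simp
qed

text \<open>
  At restarts at positive times the initial condition holds pointwise; this puts it into the integrated form which
  the comparison principle asks for.
\<close>

lemma integral_positive_part_tendsto_0:
  fixes v :: "real \<times> (real ^ 'd) \<Rightarrow> real"
  assumes cont: "continuous_on ({t0..t1} \<times> UNIV) v" and t: "t0 < t1"
    and nonpos: "\<And>x. v (t0, x) \<le> 0"
  shows "((\<lambda>t. integral cell (\<lambda>x. max 0 (v (t, x)))) \<longlongrightarrow> 0) (at_right t0)"
proof -
  have "continuous_on ({t0..t1} \<times> UNIV) (\<lambda>z. max 0 (v z))"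
    by (intro continuous_on_max continuous_on_const cont)
  then have "continuous_on ({t0..t1} \<times> cbox 0 One) (\<lambda>(t, x). max 0 (v (t, x)))"
    by (simp add: case_prod_beta) (rule continuous_on_subset, auto)
  then have "continuous_on {t0..t1} (\<lambda>t. integral cell (\<lambda>x. max 0 (v (t, x))))"
    unfolding cell_def by (rule integral_continuous_on_param)
  then have "((\<lambda>t. integral cell (\<lambda>x. max 0 (v (t, x)))) \<longlongrightarrow> integral cell (\<lambda>x. max 0 (v (t0, x)))) (at t0 within {t0..t1})"
    using t by (simp add: continuous_on_def)
  then show ?thesis
    using t nonpos by (simp add: at_within_Icc_at_right max_absorb1)
qed

section \<open>The barrier with piecewise constant parameter\<close>

text \<open>
  The properties of the nonlinearity and of the solutions started from constants on which the bound rests, in a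
  form that is symmetric under reflection at the origin. The slope condition follows from the upper
  bound on \<open>\<partial>\<^sub>a\<Phi>\<close> by the mean value theorem.
\<close>

locale initial_value_family =
  fixes m M T \<delta> :: real
    and f :: "real \<times> (real ^ 'd) \<Rightarrow> real \<Rightarrow> real"
    and w :: "real \<times> (real ^ 'd) \<Rightarrow> real \<Rightarrow> real"
  assumes \<delta>: "0 \<le> \<delta>"
    and f_bounded: "\<And>t x b. 0 < t \<Longrightarrow> \<bar>f (t, x) b\<bar> \<le> M"
    and f_lipschitz: "\<And>R. \<exists>L\<ge>0. \<forall>t x a b. 0 < t \<longrightarrow> t \<le> T \<longrightarrow> \<bar>a\<bar> \<le> R \<longrightarrow> \<bar>b\<bar> \<le> R \<longrightarrow>
      \<bar>f (t, x) a - f (t, x) b\<bar> \<le> L * \<bar>a - b\<bar>"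
    and w_solution: "\<And>a. classical_solution m (\<lambda>z b. m\<^sup>2 * a + f z b) (\<lambda>z. w z a)"
    and w_init: "\<And>a. ((\<lambda>t. integral cell (\<lambda>x. \<bar>w (t, x) a - a\<bar>)) \<longlongrightarrow> 0) (at_right 0)"
    and w_close: "\<And>t x a. 0 < t \<Longrightarrow> t \<le> T \<Longrightarrow> \<bar>w (t, x) a - a\<bar> \<le> \<delta>"
    and w_slope: "\<And>t x a b. 0 < t \<Longrightarrow> t \<le> T \<Longrightarrow> a \<le> b \<Longrightarrow> w (t, x) b - w (t, x) a \<le> (1 + \<delta>) * (b - a)"
begin

text \<open>
  Reflection exchanges upper and lower bounds.
\<close>

lemma reflected:
  "initial_value_family m M T \<delta> (\<lambda>z b. - f z (- b)) (\<lambda>z a. - w z (- a))"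
proof
  show "classical_solution m (\<lambda>z b. m\<^sup>2 * a + - f z (- b)) (\<lambda>z. - w z (- a))" for a
    using classical_solution_minus[OF w_solution[of "- a"]] by simp
  show "((\<lambda>t. integral cell (\<lambda>x. \<bar>- w (t, x) (- a) - a\<bar>)) \<longlongrightarrow> 0) (at_right 0)" for a
  proof -
    have "\<bar>- w z (- a) - a\<bar> = \<bar>w z (- a) - (- a)\<bar>" for z by simp
    then show ?thesis using w_init[of "- a"] by simp
  qed
  show "\<exists>L\<ge>0. \<forall>t x a b. 0 < t \<longrightarrow> t \<le> T \<longrightarrow> \<bar>a\<bar> \<le> R \<longrightarrow> \<bar>b\<bar> \<le> R \<longrightarrow>
      \<bar>- f (t, x) (- a) - - f (t, x) (- b)\<bar> \<le> L * \<bar>a - b\<bar>" for R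
  proof -
    obtain L where L: "0 \<le> L" "\<And>t x a b. 0 < t \<Longrightarrow> t \<le> T \<Longrightarrow> \<bar>a\<bar> \<le> R \<Longrightarrow> \<bar>b\<bar> \<le> R \<Longrightarrow>
        \<bar>f (t, x) a - f (t, x) b\<bar> \<le> L * \<bar>a - b\<bar>"
      using f_lipschitz[of R] by blast
    have "\<bar>- f (t, x) (- a) - - f (t, x) (- b)\<bar> \<le> L * \<bar>a - b\<bar>"
      if "0 < t" "t \<le> T" "\<bar>a\<bar> \<le> R" "\<bar>b\<bar> \<le> R" for t x a b
      using L(2)[of t "- a" "- b" x] that by (simp add: abs_minus_commute)
    with L(1) show ?thesis by blast
  qed
  show "\<bar>- w (t, x) (- a) - a\<bar> \<le> \<delta>" if "0 < t" "t \<le> T" for t x a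
    using w_close[OF that, of x "- a"] by simp
  show "- w (t, x) (- b) - - w (t, x) (- a) \<le> (1 + \<delta>) * (b - a)" if "0 < t" "t \<le> T" "a \<le> b" for t x a b
    using w_slope[of t "- b" "- a" x] that by simp
qed (use \<delta> f_bounded in auto)

text \<open>
  At the end of the \<open>k\<close>-th interval \<open>u\<close> lies below the solution started from the constant that is valid on this
  interval. The first interval uses the initial condition in \<open>L\<^sup>1\<close>. On the following ones the jump of the parameter from
  \<open>a\<close> to \<open>a'\<close> costs at most \<open>(1 + \<delta>) \<kappa> h a = \<theta> m\<^sup>2 a h\<close>, which the affine correction with slope
  \<open>c = \<theta> m\<^sup>2 a\<close> absorbs exactly; the condition on \<open>h\<close> says that the surplus \<open>m\<^sup>2 a'\<close> can pay for this slope.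
\<close>

lemma barrier_chain:
  assumes u: "classical_solution m f u"
    and init: "((\<lambda>t. integral cell (\<lambda>x. max 0 (u (t, x) - A))) \<longlongrightarrow> 0) (at_right 0)"
    and A: "0 \<le> A" and L: "0 \<le> L"
    and lip: "\<And>t x a. 0 < t \<Longrightarrow> t \<le> T \<Longrightarrow> 0 \<le> a \<Longrightarrow> a \<le> A \<Longrightarrow>
      \<bar>f (t, x) (u (t, x)) - f (t, x) (w (t, x) a)\<bar> \<le> L * \<bar>u (t, x) - w (t, x) a\<bar>"
    and \<theta>: "0 \<le> \<theta>" and \<kappa>: "\<kappa> = \<theta> * (m\<^sup>2 / (1 + \<delta>))"
    and h: "0 < h" and step: "\<theta> * (1 + L * h) \<le> exp (- \<kappa> * h)"
    and k: "real (Suc k) * h \<le> T"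
  shows "u (real (Suc k) * h, x) \<le> w (real (Suc k) * h, x) (A * exp (- \<kappa> * h) ^ k)"
  using k
proof (induction k arbitrary: x)
  case 0
  have hT: "h \<le> T" using 0 by simp
  have "u (h, x) \<le> w (h, x) A + 0 * (h - h)"
  proof (rule comparison_with_barrier[OF u w_solution[of A] order_refl L order_refl, where ?t1.0 = h])
    show "((\<lambda>t. integral cell (\<lambda>x. max 0 (u (t, x) - w (t, x) A - 0 * (h - t)))) \<longlongrightarrow> 0) (at_right 0)"
    proof (rule tendsto_sandwich[OF _ _ tendsto_const])
      show "((\<lambda>t. integral cell (\<lambda>x. max 0 (u (t, x) - A)) + integral cell (\<lambda>x. \<bar>w (t, x) A - A\<bar>)) \<longlongrightarrow> 0) (at_right 0)"
        using tendsto_add[OF init w_init[of A]] by simp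
      have int: "(\<lambda>x. max 0 (u (s, x) - A)) integrable_on cell" "(\<lambda>x. \<bar>w (s, x) A - A\<bar>) integrable_on cell"
        "(\<lambda>x. max 0 (u (s, x) - w (s, x) A - 0 * (h - s))) integrable_on cell" if "0 < s" for s
        by (intro integrable_on_cell continuous_intros
            classical_solution_slice[OF u that] classical_solution_slice[OF w_solution that])+
      show "\<forall>\<^sub>F s in at_right 0. 0 \<le> integral cell (\<lambda>x. max 0 (u (s, x) - w (s, x) A - 0 * (h - s)))"
        unfolding eventually_at_right_field
        by (intro exI[of _ 1] conjI allI impI integral_nonneg int) auto
      have "integral cell (\<lambda>x. max 0 (u (s, x) - w (s, x) A - 0 * (h - s)))
          \<le> integral cell (\<lambda>x. max 0 (u (s, x) - A)) + integral cell (\<lambda>x. \<bar>w (s, x) A - A\<bar>)" if s: "0 < s" for s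
      proof -
        have "integral cell (\<lambda>x. max 0 (u (s, x) - w (s, x) A - 0 * (h - s)))
            \<le> integral cell (\<lambda>x. max 0 (u (s, x) - A) + \<bar>w (s, x) A - A\<bar>)"
          by (intro integral_le integrable_add int s) auto
        also have "\<dots> = integral cell (\<lambda>x. max 0 (u (s, x) - A)) + integral cell (\<lambda>x. \<bar>w (s, x) A - A\<bar>)"
          by (intro integral_add int s)
        finally show ?thesis .
      qed
      then show "\<forall>\<^sub>F s in at_right 0. integral cell (\<lambda>x. max 0 (u (s, x) - w (s, x) A - 0 * (h - s)))
          \<le> integral cell (\<lambda>x. max 0 (u (s, x) - A)) + integral cell (\<lambda>x. \<bar>w (s, x) A - A\<bar>)"
        unfolding eventually_at_right_field by (intro exI[of _ 1]) auto
    qed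
  qed (use A h hT lip in auto)
  then show ?case by simp
next
  case (Suc k)
  define t0 where "t0 = real (Suc k) * h"
  define t1 where "t1 = real (Suc (Suc k)) * h"
  define a where "a = A * exp (- \<kappa> * h) ^ k"
  define a' where "a' = A * exp (- \<kappa> * h) ^ Suc k"
  define c where "c = \<theta> * m\<^sup>2 * a"
  have t0: "0 < t0" unfolding t0_def using h by (simp del: of_nat_Suc)
  have t1: "t1 = t0 + h" unfolding t0_def t1_def by (simp add: algebra_simps)
  have T: "t1 \<le> T" "t0 \<le> T" using Suc.prems t1 h unfolding t1_def by auto
  have \<kappa>0: "0 \<le> \<kappa>" unfolding \<kappa> using \<theta> \<delta> by simp
  have q: "exp (- \<kappa> * h) \<le> 1" using \<kappa>0 h by simp
  have a_nonneg: "0 \<le> a" "0 \<le> a'" unfolding a_def a'_def using A by simp_all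
  have a': "a' = exp (- \<kappa> * h) * a" unfolding a_def a'_def by simp
  have a'_le: "a' \<le> A"
    unfolding a'_def using power_le_one[of "exp (- \<kappa> * h)" "Suc k"] q A
    by (intro mult_left_le) auto
  have aa': "a' \<le> a" unfolding a' using a_nonneg(1) q by (intro mult_left_le_one_le) auto
  have c: "0 \<le> c" unfolding c_def using \<theta> a_nonneg by simp
  have IH: "u (t0, y) \<le> w (t0, y) a" for y
    using Suc.IH[of y] T(2) unfolding t0_def a_def by simp
  have gap: "(1 + \<delta>) * (a - a') \<le> c * h"
  proof -
    have "1 - exp (- \<kappa> * h) \<le> \<kappa> * h" using exp_ge_add_one_self[of "- \<kappa> * h"] by linarith
    then have "a - a' \<le> \<kappa> * h * a"
      unfolding a' using mult_right_mono[OF _ a_nonneg(1)] by (simp add: left_diff_distrib) (metis left_diff_distrib mult_1)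
    then have "(1 + \<delta>) * (a - a') \<le> (1 + \<delta>) * (\<kappa> * h * a)" using \<delta> by (intro mult_left_mono) auto
    also have "\<dots> = c * h" unfolding c_def \<kappa> using \<delta> by (simp add: field_simps)
    finally show ?thesis .
  qed
  have "u (t1, x) \<le> w (t1, x) a' + c * (t1 - t1)"
  proof (rule comparison_with_barrier[OF u w_solution[of a'] _ L c, where ?t0.0 = t0])
    show "\<bar>f (t, x) (u (t, x)) - f (t, x) (w (t, x) a')\<bar> \<le> L * \<bar>u (t, x) - w (t, x) a'\<bar>"
      if "t0 < t" "t \<le> t1" for t x
      using lip[of t a' x] that t0 T a_nonneg a'_le by simp
    have "\<theta> * (1 + L * h) * (m\<^sup>2 * a) \<le> exp (- \<kappa> * h) * (m\<^sup>2 * a)"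
      using step a_nonneg by (intro mult_right_mono) auto
    then show "c * (1 + L * (t1 - t0)) \<le> m\<^sup>2 * a'"
      unfolding c_def a' t1 by (simp add: mult_ac)
    show "((\<lambda>t. integral cell (\<lambda>x. max 0 (u (t, x) - w (t, x) a' - c * (t1 - t)))) \<longlongrightarrow> 0) (at_right t0)"
    proof -
      let ?v = "\<lambda>z. u z - w z a' - c * (t1 - fst z)"
      have "continuous_on ({t0..t1} \<times> UNIV) u" "continuous_on ({t0..t1} \<times> UNIV) (\<lambda>z. w z a')"
        using classical_solution_continuous[OF u] classical_solution_continuous[OF w_solution, of a'] t0
        by (auto elim!: continuous_on_subset)
      then have "continuous_on ({t0..t1} \<times> UNIV) ?v"
        by (intro continuous_intros)
      moreover have "?v (t0, y) \<le> 0" for y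
        using IH[of y] gap w_slope[OF t0 T(2) aa', of y] unfolding t1 by simp
      ultimately show ?thesis
        using integral_positive_part_tendsto_0[of t0 t1 ?v] h t1 by simp
    qed
  qed (use t0 t1 h in auto)
  then show ?case unfolding t1_def a'_def by simp
qed

theorem solution_upper_bound:
  assumes u: "classical_solution m f u"
    and init: "((\<lambda>t. integral cell (\<lambda>x. max 0 (u (t, x) - A))) \<longlongrightarrow> 0) (at_right 0)"
    and init': "((\<lambda>t. integral cell (\<lambda>x. max 0 (- u (t, x) - A))) \<longlongrightarrow> 0) (at_right 0)"
    and A: "0 \<le> A" and t: "0 < t" "t \<le> T"
  shows "u (t, x) \<le> exp (- (m\<^sup>2 / (1 + \<delta>)) * t) * A + \<delta>"
proof -
  have M: "0 \<le> M" using f_bounded[of 1 0 0] by (meson abs_ge_zero order_trans zero_less_one)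
  define R where "R = A + M * T + \<delta>"
  have u_bounded: "\<bar>u (s, y)\<bar> \<le> R" if s: "0 < s" "s \<le> T" for s y
  proof -
    have "f (t, x) b \<le> M" "- f (t, x) (- b) \<le> M" if "0 < t" for t x b
      using f_bounded[OF that, of x b] f_bounded[OF that, of x "- b"] by auto
    then have "u (s, y) \<le> A + M * s" "- u (s, y) \<le> A + M * s"
      using comparison_bounded_rhs[OF u _ A M init s(1)]
        comparison_bounded_rhs[OF classical_solution_minus[OF u] _ A M init' s(1)] by blast+
    moreover have "M * s \<le> M * T" using s M by (intro mult_left_mono) auto
    ultimately show ?thesis unfolding R_def using \<delta> by linarith
  qed
  have w_bounded: "\<bar>w (s, y) a\<bar> \<le> R" if "0 < s" "s \<le> T" "0 \<le> a" "a \<le> A" for s y a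
  proof -
    have "0 \<le> M * T" using M t by simp
    then show ?thesis
      using w_close[OF that(1,2), of y a] that(3,4) unfolding R_def by linarith
  qed
  \<comment> \<open>All barriers and the solution itself take values in [-R, R], where f is Lipschitz.\<close>
  obtain L where L: "0 \<le> L" and lip: "\<And>t x a b. 0 < t \<Longrightarrow> t \<le> T \<Longrightarrow> \<bar>a\<bar> \<le> R \<Longrightarrow> \<bar>b\<bar> \<le> R \<Longrightarrow>
      \<bar>f (t, x) a - f (t, x) b\<bar> \<le> L * \<bar>a - b\<bar>"
    using f_lipschitz[of R] by blast
  define rate where "rate = m\<^sup>2 / (1 + \<delta>)"
  \<comment> \<open>At a rate reduced by the factor \<theta>, a partition of [0, t] into sufficiently many equal intervals is
     admissible. After n + 1 intervals the parameter has jumped only n times, hence the extra factor, which tends to 1.\<close>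
  have bound: "u (t, x) \<le> A * exp (- (\<theta> * rate) * t) + \<delta>" if \<theta>: "0 < \<theta>" "\<theta> < 1" for \<theta>
  proof -
    define \<kappa> where "\<kappa> = \<theta> * rate"
    have inv: "(\<lambda>n. t / real (Suc n)) \<longlonglongrightarrow> 0"
      using tendsto_mult[OF tendsto_const LIMSEQ_inverse_real_of_nat, of t] by (simp add: divide_inverse)
    have ev: "\<forall>\<^sub>F n in sequentially. u (t, x) \<le> A * exp (- \<kappa> * t) * exp (\<kappa> * (t / real (Suc n))) + \<delta>"
    proof -
      have lim: "(\<lambda>n. exp (- \<kappa> * (t / real (Suc n))) - \<theta> * (1 + L * (t / real (Suc n))))
          \<longlonglongrightarrow> exp (- \<kappa> * 0) - \<theta> * (1 + L * 0)"
        by (intro tendsto_intros inv)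
      have "\<forall>\<^sub>F n in sequentially. 0 < exp (- \<kappa> * (t / real (Suc n))) - \<theta> * (1 + L * (t / real (Suc n)))"
        by (rule order_tendstoD(1)[OF lim]) (use \<theta> in simp)
      then show ?thesis
      proof eventually_elim
        case (elim n)
        define h where "h = t / real (Suc n)"
        have h: "0 < h" "real (Suc n) * h = t" unfolding h_def using t by (auto simp del: of_nat_Suc)
        let ?a = "A * exp (- \<kappa> * h) ^ n"
        have "u (real (Suc n) * h, x) \<le> w (real (Suc n) * h, x) ?a"
        proof (rule barrier_chain[OF u init A L])
          show "\<bar>f (s, y) (u (s, y)) - f (s, y) (w (s, y) a)\<bar> \<le> L * \<bar>u (s, y) - w (s, y) a\<bar>"
            if "0 < s" "s \<le> T" "0 \<le> a" "a \<le> A" for s y a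
            using lip that u_bounded w_bounded by simp
          show "\<theta> * (1 + L * h) \<le> exp (- \<kappa> * h)" using elim unfolding h_def by simp
        qed (use \<theta> h t \<kappa>_def rate_def in auto)
        then have "u (t, x) \<le> ?a + \<delta>"
          using w_close[OF t, of x ?a] h(2) by simp
        moreover have "?a = A * exp (- \<kappa> * t) * exp (\<kappa> * h)"
        proof -
          have "exp (- \<kappa> * h) ^ n = exp (real n * (- \<kappa> * h))" by (rule exp_of_nat_mult[symmetric])
          also have "real n * (- \<kappa> * h) = - \<kappa> * t + \<kappa> * h"
            using h(2) by (simp add: algebra_simps) (metis distrib_left mult.commute mult.left_commute mult_1_right)
          finally show ?thesis by (simp only: exp_add mult.assoc)
        qed
        ultimately show ?case by (simp only: h_def)
      qed
    qed
    have "(\<lambda>n. A * exp (- \<kappa> * t) * exp (\<kappa> * (t / real (Suc n))) + \<delta>) \<longlonglongrightarrow> A * exp (- \<kappa> * t) * exp (\<kappa> * 0) + \<delta>"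
      by (intro tendsto_intros inv)
    from tendsto_lowerbound[OF this ev] show ?thesis by (simp add: \<kappa>_def)
  qed
  have "((\<lambda>\<theta>. A * exp (- (\<theta> * rate) * t) + \<delta>) \<longlongrightarrow> A * exp (- (1 * rate) * t) + \<delta>) (at_left 1)"
    by (intro tendsto_intros)
  moreover have "\<forall>\<^sub>F \<theta> in at_left 1. u (t, x) \<le> A * exp (- (\<theta> * rate) * t) + \<delta>"
    unfolding eventually_at_left_field using bound by (intro exI[of _ 0]) auto
  ultimately have "u (t, x) \<le> A * exp (- (1 * rate) * t) + \<delta>"
    by (rule tendsto_lowerbound) simp
  then show ?thesis unfolding rate_def by (simp add: mult.commute)
qed

end

section \<open>Smooth solutions and smooth nonlinearities\<close>

lemma Ck_on_1D:
  assumes "Ck_on (Suc 0) U g"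
  shows "x \<in> U \<Longrightarrow> (g has_derivative frechet_derivative g (at x)) (at x)"
    and "continuous_on U (\<lambda>x. frechet_derivative g (at x) v)"
    and "continuous_on U g"
  using assms
  by (auto simp: frechet_derivative_works[symmetric] intro!: continuous_at_imp_continuous_on
      dest: differentiable_imp_continuous_within)

lemma directional_derivative:
  fixes g :: "'a::real_normed_vector \<Rightarrow> real"
  assumes "(g has_derivative g') (at x)" "c s = x" "(c has_vector_derivative v) (at s)"
  shows "((\<lambda>s. g (c s)) has_real_derivative g' v) (at s)"
proof -
  have "((\<lambda>s. g (c s)) has_derivative (\<lambda>h. g' (h *\<^sub>R v))) (at s)"
    using has_derivative_compose[of c "\<lambda>h. h *\<^sub>R v" s UNIV g g'] assms
    by (simp add: has_vector_derivative_def)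
  moreover have "g' (h *\<^sub>R v) = g' v * h" for h
    using linear_cmul[OF has_derivative_linear[OF assms(1)]] by simp
  ultimately show ?thesis
    by (simp add: has_field_derivative_def)
qed

text \<open>
  On an open set the smooth extension coincides with the function near every point of the set, so the Frechet
  derivatives of the extension provide the partial derivatives of the function.
\<close>

lemma smooth_on_parabolic_jet:
  fixes v :: "real \<times> (real ^ 'd) \<Rightarrow> real"
  assumes "smooth_on ({0<..} \<times> UNIV) v"
  obtains vt vx vxx where "parabolic_jet v vt vx vxx"
    "\<And>t x. 0 < t \<Longrightarrow> time_deriv v (t, x) = vt (t, x)"
    "\<And>t x. 0 < t \<Longrightarrow> laplacian v (t, x) = (\<Sum>i\<in>UNIV. vxx i (t, x))"
proof -
  let ?S = "{0<..} \<times> UNIV :: (real \<times> (real ^ 'd)) set"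
  obtain U g where S: "?S \<subseteq> U" and ck: "\<And>k. Ck_on k U g" and eq: "\<And>x. x \<in> ?S \<Longrightarrow> g x = v x"
    using assms unfolding smooth_on_def by blast
  have c1: "Ck_on (Suc 0) U g" by (rule ck)
  have c2: "Ck_on (Suc 0) U (\<lambda>x. frechet_derivative g (at x) e)" for e
    using ck[of "Suc (Suc 0)"] by (subst (asm) Ck_on.simps) blast
  define gt where "gt = (\<lambda>z. frechet_derivative g (at z) (1, 0))"
  define gx where "gx = (\<lambda>(i :: 'd) z. frechet_derivative g (at z) (0, axis i 1))"
  define gxx where "gxx = (\<lambda>i z. frechet_derivative (gx i) (at z) (0, axis i 1))"
  have in_U: "(t, x) \<in> U" if "0 < t" for t x using S that by auto
  have line: "((\<lambda>h. (t, x + h *\<^sub>R axis i 1)) has_vector_derivative (0, axis i 1)) (at s)"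
    for t :: real and x :: "real ^ 'd" and i s
    by (auto intro!: derivative_eq_intros has_vector_derivative_Pair simp: has_vector_derivative_def)
  have dt: "((\<lambda>s. v (s, x)) has_real_derivative gt (t, x)) (at t)" if "0 < t" for t x
  proof (rule has_field_derivative_transform_within_open[where S = "{0<..}"])
    have "((\<lambda>s. (s, x)) has_vector_derivative (1, 0)) (at t)"
      by (auto intro!: derivative_eq_intros simp: has_vector_derivative_def)
    then show "((\<lambda>s. g (s, x)) has_real_derivative gt (t, x)) (at t)"
      unfolding gt_def by (intro directional_derivative[OF Ck_on_1D(1)[OF c1 in_U[OF that]]]) auto
  qed (use that eq in auto)
  have dx: "((\<lambda>h. v (t, x + h *\<^sub>R axis i 1)) has_real_derivative gx i (t, x + s *\<^sub>R axis i 1)) (at s)"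
    if "0 < t" for t x i s
  proof -
    have "((\<lambda>h. g (t, x + h *\<^sub>R axis i 1)) has_real_derivative gx i (t, x + s *\<^sub>R axis i 1)) (at s)"
      unfolding gx_def by (rule directional_derivative[OF Ck_on_1D(1)[OF c1 in_U[OF that]] refl line])
    then show ?thesis using eq that by simp
  qed
  have dxx: "((\<lambda>h. gx i (t, x + h *\<^sub>R axis i 1)) has_real_derivative gxx i (t, x)) (at 0)"
    if "0 < t" for t x i
    unfolding gxx_def
    by (rule directional_derivative[OF Ck_on_1D(1)[OF _ in_U[OF that]] _ line])
      (use c2 in \<open>auto simp: gx_def\<close>)
  have "parabolic_jet v gt gx gxx"
    unfolding parabolic_jet_def
  proof (intro conjI allI impI)
    show "continuous_on ?S v"
      using continuous_on_subset[OF Ck_on_1D(3)[OF c1] S] eq by (simp cong: continuous_on_cong)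
    show "continuous_on ?S gt" "continuous_on ?S (gx i)" for i
      unfolding gt_def gx_def by (rule continuous_on_subset[OF Ck_on_1D(2)[OF c1] S])+
    show "continuous_on ?S (gxx i)" for i
      unfolding gxx_def gx_def by (rule continuous_on_subset[OF Ck_on_1D(2)[OF c2] S])
  qed (use dt dx[where s = 0] dxx in auto)
  moreover have "time_deriv v (t, x) = gt (t, x)" if "0 < t" for t x
    unfolding time_deriv_def using dt[OF that] by (simp add: DERIV_imp_deriv)
  moreover have "laplacian v (t, x) = (\<Sum>i\<in>UNIV. gxx i (t, x))" if "0 < t" for t x
  proof -
    have "deriv (\<lambda>h. v (t, x + h *\<^sub>R axis i 1)) = (\<lambda>h. gx i (t, x + h *\<^sub>R axis i 1))" for i
      using DERIV_imp_deriv[OF dx[OF that]] by blast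
    then have "(deriv ^^ 2) (\<lambda>h. v (t, x + h *\<^sub>R axis i 1)) 0 = gxx i (t, x)" for i
      using DERIV_imp_deriv[OF dxx[OF that]] by (simp add: numeral_2_eq_2)
    then show ?thesis unfolding laplacian_def by simp
  qed
  ultimately show ?thesis using that by blast
qed

lemma solves_ivp_classical:
  assumes "solves_ivp m G v0 v"
  shows "classical_solution m G v"
proof -
  obtain vt vx vxx where jet: "parabolic_jet v vt vx vxx"
    and vt: "\<And>t x. 0 < t \<Longrightarrow> time_deriv v (t, x) = vt (t, x)"
    and lap: "\<And>t x. 0 < t \<Longrightarrow> laplacian v (t, x) = (\<Sum>i\<in>UNIV. vxx i (t, x))"
    using assms smooth_on_parabolic_jet[of v] unfolding solves_ivp_def by blast
  have "heat_op m v (t, x) = G (t, x) (v (t, x))" if "0 < t" for t x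
    using assms that unfolding solves_ivp_def by auto
  then have "vt (t, x) - (\<Sum>i\<in>UNIV. vxx i (t, x)) + m\<^sup>2 * v (t, x) = G (t, x) (v (t, x))" if "0 < t" for t x
    using that vt lap unfolding heat_op_def by simp
  moreover have "torus_fun (\<lambda>x. v (t, x))" if "0 < t" for t
    using assms that unfolding solves_ivp_def by auto
  ultimately show ?thesis
    using jet unfolding classical_solution_def by blast
qed

text \<open>
  The derivative in the last argument is bounded on compact sets, and by periodicity the space variable may be taken
  from the compact cell.
\<close>

lemma smooth_bounded_nonlinearity_lipschitz:
  fixes F :: "real \<times> (real ^ 'd) \<Rightarrow> real \<Rightarrow> real"
  assumes F: "smooth_bounded_nonlinearity F"
  shows "\<exists>L\<ge>0. \<forall>t x a b. 0 < t \<longrightarrow> t \<le> T \<longrightarrow> \<bar>a\<bar> \<le> R \<longrightarrow> \<bar>b\<bar> \<le> R \<longrightarrow>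
    \<bar>F (t, x) a - F (t, x) b\<bar> \<le> L * \<bar>a - b\<bar>"
proof -
  let ?S = "({0..} \<times> UNIV) \<times> UNIV :: ((real \<times> (real ^ 'd)) \<times> real) set"
  obtain U g where S: "?S \<subseteq> U" and ck: "\<And>k. Ck_on k U g"
    and eq: "\<And>x. x \<in> ?S \<Longrightarrow> g x = (\<lambda>(z, a). F z a) x"
    using F unfolding smooth_bounded_nonlinearity_def smooth_on_def by blast
  have c1: "Ck_on (Suc 0) U g" by (rule ck)
  define D where "D = (\<lambda>p. frechet_derivative g (at p) ((0, 0), 1))"
  let ?K = "({0..T} \<times> cell) \<times> {- R..R}"
  have "compact ?K" unfolding cell_def by (intro compact_Times compact_Icc compact_cbox)
  moreover have "continuous_on ?K D"
    unfolding D_def by (rule continuous_on_subset[OF Ck_on_1D(2)[OF c1]]) (use S in auto)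
  ultimately have "bounded (D ` ?K)"
    by (intro compact_imp_bounded compact_continuous_image)
  then obtain L where L: "0 < L" "\<And>p. p \<in> ?K \<Longrightarrow> \<bar>D p\<bar> \<le> L"
    unfolding bounded_pos by (metis imageI real_norm_def)
  have "\<bar>F (t, x) a - F (t, x) b\<bar> \<le> L * \<bar>a - b\<bar>"
    if t: "0 < t" "t \<le> T" and ab: "\<bar>a\<bar> \<le> R" "\<bar>b\<bar> \<le> R" for t x a b
  proof -
    have per: "torus_fun (\<lambda>x. F (t, x) c)" for c
      using F t unfolding smooth_bounded_nonlinearity_def by simp
    obtain y where y: "y \<in> cell" "\<And>g :: real ^ 'd \<Rightarrow> real. torus_fun g \<Longrightarrow> g y = g x"
      by (rule cell_representative[of x]) blast
    have "(F (t, y) has_real_derivative D ((t, y), c)) (at c)" for c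
    proof -
      have "((\<lambda>c. ((t, y), c)) has_vector_derivative ((0, 0), 1)) (at c)"
        by (auto intro!: derivative_eq_intros simp: has_vector_derivative_def zero_prod_def)
      moreover have "((t, y), c) \<in> U" using S t by auto
      ultimately have "((\<lambda>c. g ((t, y), c)) has_real_derivative D ((t, y), c)) (at c)"
        unfolding D_def by (intro directional_derivative[OF Ck_on_1D(1)[OF c1]]) auto
      moreover have "(\<lambda>c. g ((t, y), c)) = F (t, y)" using eq t by auto
      ultimately show ?thesis by simp
    qed
    then have "norm (F (t, y) a - F (t, y) b) \<le> L * norm (a - b)"
      using L(2) t y(1) ab
      by (intro field_differentiable_bound[of "{- R..R}" _ "\<lambda>c. D ((t, y), c)"])
        (auto intro: has_field_derivative_at_within)
    moreover have "F (t, y) c = F (t, x) c" for c using y(2)[OF per] by simp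
    ultimately show ?thesis by simp
  qed
  with L(1) show ?thesis by (intro exI[of _ L]) auto
qed

section \<open>Initial conditions on the torus\<close>

definition half_open_cell :: "(real ^ 'd) set" where
  "half_open_cell = {x. \<forall>i. 0 \<le> x $ i \<and> x $ i < 1}"

lemma half_open_cell:
  "half_open_cell \<subseteq> (cell :: (real ^ 'd) set)"
  "negligible (cell - half_open_cell :: (real ^ 'd) set)"
  "(half_open_cell :: (real ^ 'd) set) \<in> sets lebesgue"
proof -
  have box: "box 0 One \<subseteq> (half_open_cell :: (real ^ 'd) set)"
    unfolding half_open_cell_def mem_box_cart subset_iff One_nth by (auto intro: less_imp_le)
  show sub: "half_open_cell \<subseteq> (cell :: (real ^ 'd) set)"
    unfolding half_open_cell_def cell_def mem_box_cart subset_iff One_nth by (auto intro: less_imp_le)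
  show neg: "negligible (cell - half_open_cell :: (real ^ 'd) set)"
    by (rule negligible_subset[OF negligible_frontier_interval[of 0 One]]) (use box cell_def in auto)
  have "half_open_cell = cell - (cell - half_open_cell :: (real ^ 'd) set)" using sub by blast
  moreover have "cell - (cell - half_open_cell :: (real ^ 'd) set) \<in> sets lebesgue"
    unfolding cell_def
    by (rule sets.Diff, simp, rule negligible_imp_sets, rule neg[unfolded cell_def])
  ultimately show "(half_open_cell :: (real ^ 'd) set) \<in> sets lebesgue" by simp
qed

lemma torus_measure_half_open: "torus_measure = lebesgue_on half_open_cell"
  unfolding torus_measure_def half_open_cell_def ..

lemma continuous_torus_measure:
  fixes f :: "real ^ 'd \<Rightarrow> real"
  assumes "continuous_on UNIV f"
  shows "integrable torus_measure f" "integral\<^sup>L torus_measure f = integral cell f"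
proof -
  have "integrable (lebesgue_on cell) f"
    unfolding cell_def by (rule continuous_imp_integrable, rule continuous_on_subset[OF assms]) auto
  then have "set_integrable lebesgue cell f"
    unfolding set_integrable_def by (subst (asm) integrable_restrict_space) (auto simp: cell_def)
  then have "set_integrable lebesgue half_open_cell f"
    by (rule set_integrable_subset) (use half_open_cell in auto)
  then show int: "integrable torus_measure f"
    unfolding torus_measure_half_open set_integrable_def
    by (subst integrable_restrict_space) (use half_open_cell in auto)
  have "integral\<^sup>L torus_measure f = integral half_open_cell f"
    using int half_open_cell(3) unfolding torus_measure_half_open by (rule lebesgue_integral_eq_integral)
  also have "\<dots> = integral cell f"
    by (rule integral_spike_set) (use half_open_cell in \<open>auto intro: negligible_subset\<close>)
  finally show "integral\<^sup>L torus_measure f = integral cell f" .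
qed

lemma emeasure_torus_measure:
  "emeasure (torus_measure :: (real ^ 'd) measure) (space torus_measure) \<noteq> 0"
  "finite_measure (torus_measure :: (real ^ 'd) measure)"
proof -
  have "(half_open_cell :: (real ^ 'd) set) \<in> lmeasurable"
    using half_open_cell bounded_subset[OF bounded_cbox] unfolding cell_def
    by (metis bounded_set_imp_lmeasurable)
  then have "emeasure (torus_measure :: (real ^ 'd) measure) (space torus_measure) < \<infinity>"
    unfolding torus_measure_half_open
    by (simp add: emeasure_restrict_space fmeasurable_def space_restrict_space del: emeasure_completion)
  then show "finite_measure (torus_measure :: (real ^ 'd) measure)"
    by (intro finite_measureI) simp
  have "measure (torus_measure :: (real ^ 'd) measure) (space torus_measure) = integral cell (\<lambda>x :: real ^ 'd. 1)"
    using continuous_torus_measure(2)[of "\<lambda>x :: real ^ 'd. 1"] by simp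
  also have "\<dots> = 1" unfolding cell_def by (simp add: integral_const)
  finally show "emeasure (torus_measure :: (real ^ 'd) measure) (space torus_measure) \<noteq> 0"
    by (auto simp: measure_def)
qed


text \<open>
  Almost everywhere \<open>\<bar>u0\<bar> \<le> A\<close>, so the part of \<open>\<plusminus> u\<close> above \<open>A\<close> is at most \<open>\<bar>u - u0\<bar>\<close>.
\<close>

lemma solves_ivp_initial_excess:
  fixes u :: "real \<times> (real ^ 'd) \<Rightarrow> real"
  assumes u: "solves_ivp m G u0 u" and u0: "u0 \<in> Linf_torus" and A: "Linf_norm u0 \<le> ereal A"
    and c: "\<bar>c\<bar> = 1"
  shows "((\<lambda>t. integral cell (\<lambda>x. max 0 (c * u (t, x) - A))) \<longlongrightarrow> 0) (at_right 0)"
proof -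
  have "AE x in torus_measure. ereal \<bar>u0 x\<bar> \<le> Linf_norm u0"
    unfolding Linf_norm_def by (rule esssup_AE)
  then have bound: "AE x in torus_measure. \<bar>u0 x\<bar> \<le> A"
    by eventually_elim (metis A ereal_less_eq(3) order_trans)
  have int_u0: "integrable torus_measure u0"
    by (rule finite_measure.integrable_const_bound[OF emeasure_torus_measure(2), where B = A])
      (use bound u0 in \<open>auto simp: Linf_torus_def\<close>)
  have lim: "((\<lambda>t. \<integral>x. \<bar>u (t, x) - u0 x\<bar> \<partial>torus_measure) \<longlongrightarrow> 0) (at_right 0)"
    using u unfolding solves_ivp_def by blast
  have est: "0 \<le> integral cell (\<lambda>x. max 0 (c * u (t, x) - A)) \<and>
      integral cell (\<lambda>x. max 0 (c * u (t, x) - A)) \<le> (\<integral>x. \<bar>u (t, x) - u0 x\<bar> \<partial>torus_measure)"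
    if t: "0 < t" for t
  proof -
    have cont: "continuous_on UNIV (\<lambda>x. u (t, x))"
      using classical_solution_slice[OF solves_ivp_classical[OF u] t] .
    have cont': "continuous_on UNIV (\<lambda>x. max 0 (c * u (t, x) - A))"
      by (intro continuous_intros cont)
    have "(\<integral>x. max 0 (c * u (t, x) - A) \<partial>torus_measure) \<le> (\<integral>x. \<bar>u (t, x) - u0 x\<bar> \<partial>torus_measure)"
    proof (rule integral_mono_AE)
      show "integrable torus_measure (\<lambda>x. \<bar>u (t, x) - u0 x\<bar>)"
        using continuous_torus_measure(1)[OF cont] int_u0 by auto
      show "AE x in torus_measure. max 0 (c * u (t, x) - A) \<le> \<bar>u (t, x) - u0 x\<bar>"
        using bound by eventually_elim (use c in \<open>auto simp: abs_if split: if_splits\<close>)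
    qed (rule continuous_torus_measure[OF cont'])
    then show ?thesis
      unfolding continuous_torus_measure(2)[OF cont']
      using integrable_on_cell[OF cont'] by (auto intro: integral_nonneg)
  qed
  show ?thesis
    by (rule tendsto_sandwich[OF _ _ tendsto_const lim])
      (use est in \<open>auto simp: eventually_at_right_field intro!: exI[of _ 1]\<close>)
qed

lemma solves_ivp_initial_const:
  assumes u: "solves_ivp m G (\<lambda>x. a) u"
  shows "((\<lambda>t. integral cell (\<lambda>x. \<bar>u (t, x) - a\<bar>)) \<longlongrightarrow> 0) (at_right 0)"
proof (rule Lim_transform_eventually)
  show "((\<lambda>t. \<integral>x. \<bar>u (t, x) - a\<bar> \<partial>torus_measure) \<longlongrightarrow> 0) (at_right 0)"
    using u unfolding solves_ivp_def by blast
  have "(\<integral>x. \<bar>u (t, x) - a\<bar> \<partial>torus_measure) = integral cell (\<lambda>x. \<bar>u (t, x) - a\<bar>)" if t: "0 < t" for t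
    by (intro continuous_torus_measure(2) continuous_intros
        classical_solution_slice[OF solves_ivp_classical[OF u] t])
  then show "\<forall>\<^sub>F t in at_right 0. (\<integral>x. \<bar>u (t, x) - a\<bar> \<partial>torus_measure) = integral cell (\<lambda>x. \<bar>u (t, x) - a\<bar>)"
    unfolding eventually_at_right_field by (intro exI[of _ 1]) auto
qed

section \<open>The bound on the solution\<close>

lemma initial_value_family_of_solves_ivp:
  fixes F :: "real \<times> (real ^ 'd) \<Rightarrow> real \<Rightarrow> real"
  assumes F: "smooth_bounded_nonlinearity F"
    and \<Phi>: "\<And>a. solves_ivp m (\<lambda>z b. m\<^sup>2 * a + F z b) (\<lambda>x. a) (\<lambda>z. \<Phi> z a)"
    and \<Phi>_diff: "\<And>z a. z \<in> {0..} \<times> UNIV \<Longrightarrow> \<Phi> z field_differentiable (at a)"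
    and \<delta>: "0 \<le> \<delta>"
    and close: "\<And>t x a. 0 < t \<Longrightarrow> t \<le> T \<Longrightarrow> \<bar>\<Phi> (t, x) a - a\<bar> \<le> \<delta>"
    and deriv_le: "\<And>t x a. 0 < t \<Longrightarrow> t \<le> T \<Longrightarrow> deriv (\<Phi> (t, x)) a \<le> 1 + \<delta>"
  obtains M where "initial_value_family m M T \<delta> F \<Phi>"
proof -
  obtain M where M: "\<And>t x b. 0 < t \<Longrightarrow> \<bar>F (t, x) b\<bar> \<le> M"
  proof -
    have "bounded ((\<lambda>(z, a). F z a) ` (({0..} \<times> UNIV) \<times> UNIV))"
      using F unfolding smooth_bounded_nonlinearity_def by blast
    then obtain M where "\<And>y. y \<in> (\<lambda>(z, a). F z a) ` (({0..} \<times> UNIV) \<times> UNIV) \<Longrightarrow> norm y \<le> M"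
      unfolding bounded_iff by blast
    from this[OF image_eqI[where x = "((_, _), _)"]] show ?thesis by (intro that[of M]) auto
  qed
  have "initial_value_family m M T \<delta> F \<Phi>"
  proof
    show "\<Phi> (t, x) b - \<Phi> (t, x) a \<le> (1 + \<delta>) * (b - a)" if t: "0 < t" "t \<le> T" and ab: "a \<le> b" for t x a b
    proof -
      have der: "(\<Phi> (t, x) has_real_derivative deriv (\<Phi> (t, x)) c) (at c)" for c
        using \<Phi>_diff[of "(t, x)" c] t by (simp add: DERIV_deriv_iff_field_differentiable)
      have "((\<lambda>c. \<Phi> (t, x) c - (1 + \<delta>) * c) has_real_derivative deriv (\<Phi> (t, x)) c - (1 + \<delta>)) (at c)" for c
        by (auto intro!: derivative_eq_intros der)
      moreover have "deriv (\<Phi> (t, x)) c - (1 + \<delta>) \<le> 0" for c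
        using deriv_le[OF t, of x c] by simp
      ultimately have "\<Phi> (t, x) b - (1 + \<delta>) * b \<le> \<Phi> (t, x) a - (1 + \<delta>) * a"
        by (intro DERIV_nonpos_imp_nonincreasing[of a b "\<lambda>c. \<Phi> (t, x) c - (1 + \<delta>) * c"] ab) blast
      then show ?thesis by (simp add: right_diff_distrib)
    qed
    show "classical_solution m (\<lambda>z b. m\<^sup>2 * a + F z b) (\<lambda>z. \<Phi> z a)" for a
      by (rule solves_ivp_classical[OF \<Phi>])
    show "((\<lambda>t. integral cell (\<lambda>x. \<bar>\<Phi> (t, x) a - a\<bar>)) \<longlongrightarrow> 0) (at_right 0)" for a
      by (rule solves_ivp_initial_const[OF \<Phi>])
    show "\<exists>L\<ge>0. \<forall>t x a b. 0 < t \<longrightarrow> t \<le> T \<longrightarrow> \<bar>a\<bar> \<le> R \<longrightarrow> \<bar>b\<bar> \<le> R \<longrightarrow>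
      \<bar>F (t, x) a - F (t, x) b\<bar> \<le> L * \<bar>a - b\<bar>" for R
      by (rule smooth_bounded_nonlinearity_lipschitz[OF F])
  qed (use \<delta> close M in auto)
  then show ?thesis by (rule that)
qed

theorem proposition1p4:
  fixes F :: "real \<times> (real ^ 'd) \<Rightarrow> real \<Rightarrow> real"
    and u :: "real \<times> (real ^ 'd) \<Rightarrow> real"
    and u0 :: "real ^ 'd \<Rightarrow> real"
    and \<Phi> :: "real \<times> (real ^ 'd) \<Rightarrow> real \<Rightarrow> real"
    and m \<delta> T :: real
  assumes F: "smooth_bounded_nonlinearity F"
    and u0: "u0 \<in> Linf_torus"
    and u: "solves_ivp m F u0 u"
    and \<Phi>: "\<And>a. solves_ivp m (\<lambda>z b. m\<^sup>2 * a + F z b) (\<lambda>x. a) (\<lambda>z. \<Phi> z a)"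
    and \<Phi>_diff: "\<And>z a. z \<in> {0..} \<times> UNIV \<Longrightarrow> \<Phi> z field_differentiable (at a)"
    and \<delta>: "0 < \<delta>" "\<delta> < 1"
    and T: "0 < T"
    and \<Phi>_close: "(SUP a. SUP z\<in>{0..T} \<times> UNIV. ereal \<bar>\<Phi> z a - a\<bar>) \<le> ereal \<delta>"
    and \<Phi>_deriv_lower: "ereal (1 - \<delta>) \<le> (SUP a. SUP z\<in>{0..T} \<times> UNIV. ereal (deriv (\<Phi> z) a))"
    and \<Phi>_deriv_upper: "(SUP a. SUP z\<in>{0..T} \<times> UNIV. ereal (deriv (\<Phi> z) a)) \<le> ereal (1 + \<delta>)"
  shows "\<forall>t\<in>{0..T}. Linf_norm (\<lambda>x. u (t, x))
           \<le> ereal (exp (- (m\<^sup>2 / (1 + \<delta>)) * t)) * Linf_norm u0 + ereal \<delta>"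
proof
  fix t assume t_mem: "t \<in> {0..T}"
  have le_SUP2: "h (t, x) a \<le> c" if "(SUP a. SUP z\<in>{0..T} \<times> UNIV. ereal (h z a)) \<le> ereal c" "0 < t" "t \<le> T"
    for h :: "real \<times> (real ^ 'd) \<Rightarrow> real \<Rightarrow> real" and t x a c
  proof -
    have "ereal (h (t, x) a) \<le> (SUP z\<in>{0..T} \<times> UNIV. ereal (h z a))"
      using that by (intro SUP_upper) auto
    also have "\<dots> \<le> (SUP a. SUP z\<in>{0..T} \<times> UNIV. ereal (h z a))"
      by (rule SUP_upper) simp
    also have "\<dots> \<le> ereal c" by (rule that(1))
    finally show ?thesis by simp
  qed
  have "Linf_norm u0 < \<infinity>"
    using u0 unfolding Linf_torus_def by auto
  have "esssup torus_measure (\<lambda>x :: real ^ 'd. 0 :: ereal) \<le> Linf_norm u0"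
    unfolding Linf_norm_def by (rule esssup_mono) auto
  then have "0 \<le> Linf_norm u0"
    by (simp only: esssup_const[OF emeasure_torus_measure(1)])
  then obtain A where A: "Linf_norm u0 = ereal A" "0 \<le> A"
    using \<open>Linf_norm u0 < \<infinity>\<close> by (cases "Linf_norm u0") auto
  show "Linf_norm (\<lambda>x. u (t, x)) \<le> ereal (exp (- (m\<^sup>2 / (1 + \<delta>)) * t)) * Linf_norm u0 + ereal \<delta>"
  proof (cases "t = 0")
    case True
    have "(\<lambda>x. u (0, x)) = u0" using u unfolding solves_ivp_def by auto
    then show ?thesis using True A \<delta> by simp
  next
    case False
    then have t: "0 < t" "t \<le> T" using t_mem by auto
    obtain M where family: "initial_value_family m M T \<delta> F \<Phi>"
      using initial_value_family_of_solves_ivp[OF F \<Phi> \<Phi>_diff _ le_SUP2[OF \<Phi>_close] le_SUP2[OF \<Phi>_deriv_upper]] \<delta> by auto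
    have sol: "classical_solution m F u" by (rule solves_ivp_classical[OF u])
    have init: "((\<lambda>t. integral cell (\<lambda>x. max 0 (u (t, x) - A))) \<longlongrightarrow> 0) (at_right 0)"
      "((\<lambda>t. integral cell (\<lambda>x. max 0 (- u (t, x) - A))) \<longlongrightarrow> 0) (at_right 0)"
      using solves_ivp_initial_excess[OF u u0, of A 1] solves_ivp_initial_excess[OF u u0, of A "- 1"] A(1)
      by simp_all
    let ?b = "exp (- (m\<^sup>2 / (1 + \<delta>)) * t) * A + \<delta>"
    have "u (t, x) \<le> ?b" for x
      by (rule initial_value_family.solution_upper_bound[OF family sol init A(2) t])
    moreover have "- u (t, x) \<le> ?b" for x
      using initial_value_family.solution_upper_bound[OF initial_value_family.reflected[OF family]
          classical_solution_minus[OF sol] init(2) _ A(2) t] init(1) by simp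
    ultimately have bound: "\<bar>u (t, x)\<bar> \<le> ?b" for x
      by (simp add: abs_le_iff)
    have [measurable]: "(\<lambda>x. u (t, x)) \<in> borel_measurable torus_measure"
      using continuous_torus_measure(1)[OF classical_solution_slice[OF sol t(1)]] by (rule borel_measurable_integrable)
    have "Linf_norm (\<lambda>x. u (t, x)) \<le> ereal ?b"
      unfolding Linf_norm_def by (rule esssup_I) (use bound in auto)
    then show ?thesis using A(1) by simp
  qed
qed

end
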